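(* Let $\mathbb{F}$ be an algebraically closed field, $G(\lambda)\in\mathbb{F}(\lambda)^{p\times m}$, $\lambda_0\in\mathbb{F}$, $s\ge0$ an integer, and let $$\mathcal{L}(\lambda)=\begin{bmatrix}A_1\lambda+A_0&B_1\lambda+B_0\\-(C_1\lambda+C_0)&D_1\lambda+D_0\end{bmatrix}\in\mathbb{F}[\lambda]^{(n+(p+s))\times(n+(m+s))}$$ be a linear polynomial system matrix, with $n\times n$ state matrix $A_1\lambda+A_0$, minimal at $\lambda_0$. Then $\mathcal{L}(\lambda)$ is a linearization of $G(\lambda)$ at $\lambda_0$ if and only if the following three conditions hold: (a) $\operatorname{rank}\mathcal{L}(\lambda)=\operatorname{rank}G(\lambda)+n+s$; (b) the pole elementary divisors of $G(\lambda)$ at $\lambda_0$ are the elementary divisors of $A_1\lambda+A_0$ at $\lambda_0$; (c) the zero elementary divisors of $G(\lambda)$ at $\lambda_0$ are the elementary divisors of $\mathcal{L}(\lambda)$ at $\lambda_0$.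
   Context: $\operatorname{rank}$ of a rational matrix is its normal rank (rank over $\mathbb{F}(\lambda)$). A square rational matrix is regular at $\lambda_0\in\mathbb{F}$ if none of its entries has a pole at $\lambda_0$ and its determinant is nonzero at $\lambda_0$. Every $G(\lambda)\in\mathbb{F}(\lambda)^{p\times m}$ of normal rank $r$ can be written $G=R_1\,\mathrm{diag}\left((\lambda-\lambda_0)^{\nu_1},\ldots,(\lambda-\lambda_0)^{\nu_r},0_{(p-r)\times(m-r)}\right)R_2$ with $R_1,R_2$ rational and regular at $\lambda_0$, and with unique integers $\nu_1\le\cdots\le\nu_r$ (invariant orders at $\lambda_0$). The pole elementary divisors of $G$ at $\lambda_0$ are $(\lambda-\lambda_0)^{-\nu_i}$ for all $i$ with $\nu_i<0$; the zero elementary divisors are $(\lambda-\lambda_0)^{\nu_i}$ for all $i$ with $\nu_i>0$. For a polynomial matrix, its elementary divisors at $\lambda_0$ are the $(\lambda-\lambda_0)^{\nu_i}$ with $\nu_i\ne0$. A polynomial system matrix is a partitioned polynomial matrix $\begin{bmatrix}A&B\\-C&D\end{bmatrix}$ with $A(\lambda)$ of size $n\times n$ and $\det A(\lambda)\not\equiv0$ (if $n>0$); $A$ is its state matrix and $D+CA^{-1}B$ its transfer function matrix; if $n=0$ the blocks $A,B,C$ are empty. It is linear if all blocks have degree at most $1$. For $n>0$ it is minimal at $\lambda_0$ if $\operatorname{rank}\begin{bmatrix}A(\lambda_0)\\C(\lambda_0)\end{bmatrix}=\operatorname{rank}\begin{bmatrix}A(\lambda_0)&B(\lambda_0)\end{bmatrix}=n$;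 for $n=0$ it is by convention minimal at every point of $\mathbb{F}$. A linear polynomial system matrix $\mathcal{L}(\lambda)\in\mathbb{F}[\lambda]^{(n+q)\times(n+t)}$ with transfer function matrix $\widehat G(\lambda)\in\mathbb{F}(\lambda)^{q\times t}$ is a linearization of $G(\lambda)\in\mathbb{F}(\lambda)^{p\times m}$ at $\lambda_0$ if: $\mathcal{L}$ is minimal at $\lambda_0$, and there exist nonnegative integers $s_1,s_2$ with $s_1-s_2=q-p=t-m$ and rational matrices $R_1\in\mathbb{F}(\lambda)^{(p+s_1)\times(p+s_1)}$, $R_2\in\mathbb{F}(\lambda)^{(m+s_1)\times(m+s_1)}$ regular at $\lambda_0$ such that $R_1(\lambda)\,\mathrm{diag}(G(\lambda),I_{s_1})\,R_2(\lambda)=\mathrm{diag}(\widehat G(\lambda),I_{s_2})$. *)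

theory Defs
  imports
    "Jordan_Normal_Form.DL_Rank"
    "Jordan_Normal_Form.Gauss_Jordan_Elimination"
    "HOL-Computational_Algebra.Polynomial_Factorial"
begin

text \<open>
  Rational functions over a field \<open>'a\<close> are elements of \<open>'a poly fract\<close>. A rational matrix has type
  \<open>'a poly fract mat\<close> and a polynomial matrix has type \<open>'a poly mat\<close>; matrices may have zero rows or
  zero columns.
\<close>

type_synonym 'a rat_mat = "'a poly fract mat"

abbreviation rat_of_poly_mat :: "'a::field poly mat \<Rightarrow> 'a rat_mat" where
  "rat_of_poly_mat \<equiv> map_mat to_fract"

definition eval_mat :: "'a::field \<Rightarrow> 'a poly mat \<Rightarrow> 'a mat" where
  "eval_mat z M = map_mat (\<lambda>f. poly f z) M"

text \<open>For a rational matrix this is the normal rank, the ground field being \<open>'a poly fract\<close>.\<close>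

definition mat_rank :: "'b::field mat \<Rightarrow> nat" where
  "mat_rank M = vec_space.rank (dim_row M) M"

definition side_by_side :: "'b::zero mat \<Rightarrow> 'b mat \<Rightarrow> 'b mat" where
  "side_by_side M N = four_block_mat M N (0\<^sub>m 0 (dim_col M)) (0\<^sub>m 0 (dim_col N))"

definition diag_one :: "'b::{zero,one} mat \<Rightarrow> nat \<Rightarrow> 'b mat" where
  "diag_one M s = four_block_mat M (0\<^sub>m (dim_row M) s) (0\<^sub>m s (dim_col M)) (1\<^sub>m s)"


text \<open>
  If some representation of \<open>f\<close> has a denominator that does not vanish at \<open>z\<close>, then neither does
  the reduced denominator, since it divides every other one.
\<close>

definition has_pole_at :: "'a::field poly fract \<Rightarrow> 'a \<Rightarrow> bool" where
  "has_pole_at f z \<longleftrightarrow> \<not> (\<exists>a b. poly b z \<noteq> 0 \<and> f = Fract a b)"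

text \<open>Only meaningful if \<open>f\<close> has no pole at \<open>z\<close>.\<close>

definition rat_value :: "'a::field poly fract \<Rightarrow> 'a \<Rightarrow> 'a" where
  "rat_value f z = (THE v. \<exists>a b. poly b z \<noteq> 0 \<and> f = Fract a b \<and> v = poly a z / poly b z)"

lemma rat_value_Fract:
  fixes a b :: "'a::field poly"
  assumes "poly b z \<noteq> 0"
  shows "rat_value (Fract a b) z = poly a z / poly b z"
  unfolding rat_value_def
proof (rule the_equality)
  show "\<exists>c d. poly d z \<noteq> 0 \<and> Fract a b = Fract c d \<and> poly a z / poly b z = poly c z / poly d z"
    using assms by blast
next
  fix v
  assume "\<exists>c d. poly d z \<noteq> 0 \<and> Fract a b = Fract c d \<and> v = poly c z / poly d z"
  then obtain c d where d: "poly d z \<noteq> 0" and eq: "Fract a b = Fract c d"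
    and v: "v = poly c z / poly d z"
    by blast
  have "b \<noteq> 0" "d \<noteq> 0"
    using assms d by auto
  with eq have "a * d = c * b"
    by (simp add: eq_fract)
  then have "poly a z * poly d z = poly c z * poly b z"
    by (metis poly_mult)
  with assms d have "poly a z / poly b z = poly c z / poly d z"
    by (simp add: frac_eq_eq)
  with v show "v = poly a z / poly b z"
    by simp
qed

definition regular_mat_at :: "'a::field rat_mat \<Rightarrow> 'a \<Rightarrow> bool" where
  "regular_mat_at R z \<longleftrightarrow>
     square_mat R \<and>
     (\<forall>i<dim_row R. \<forall>j<dim_col R. \<not> has_pole_at (R $$ (i, j)) z) \<and>
     rat_value (det R) z \<noteq> 0"


definition lin_factor :: "'a::field \<Rightarrow> 'a poly fract" where
  "lin_factor z = to_fract [:- z, 1:]"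

definition local_diag :: "'a::field \<Rightarrow> nat \<Rightarrow> nat \<Rightarrow> int list \<Rightarrow> 'a rat_mat" where
  "local_diag z p m \<nu> =
     mat p m (\<lambda>(i, j). if i = j \<and> i < length \<nu> then lin_factor z powi (\<nu> ! i) else 0)"

definition is_invariant_orders_at :: "'a::field rat_mat \<Rightarrow> 'a \<Rightarrow> int list \<Rightarrow> bool" where
  "is_invariant_orders_at G z \<nu> \<longleftrightarrow>
     sorted \<nu> \<and> length \<nu> = mat_rank G \<and>
     (\<exists>R1 \<in> carrier_mat (dim_row G) (dim_row G). \<exists>R2 \<in> carrier_mat (dim_col G) (dim_col G).
        regular_mat_at R1 z \<and> regular_mat_at R2 z \<and>
        G = R1 * local_diag z (dim_row G) (dim_col G) \<nu> * R2)"

text \<open>Every rational matrix has exactly one list of invariant orders at \<open>z\<close> (local Smith form).\<close>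

definition invariant_orders_at :: "'a::field rat_mat \<Rightarrow> 'a \<Rightarrow> int list" where
  "invariant_orders_at G z = (THE \<nu>. is_invariant_orders_at G z \<nu>)"

text \<open>Elementary divisors are counted with multiplicity, hence form multisets.\<close>

definition pole_elementary_divisors :: "'a::field rat_mat \<Rightarrow> 'a \<Rightarrow> 'a poly fract multiset" where
  "pole_elementary_divisors G z =
     {# lin_factor z powi (- k). k \<in># filter_mset (\<lambda>k. k < 0) (mset (invariant_orders_at G z)) #}"

definition zero_elementary_divisors :: "'a::field rat_mat \<Rightarrow> 'a \<Rightarrow> 'a poly fract multiset" where
  "zero_elementary_divisors G z =
     {# lin_factor z powi k. k \<in># filter_mset (\<lambda>k. k > 0) (mset (invariant_orders_at G z)) #}"

definition elementary_divisors :: "'a::field poly mat \<Rightarrow> 'a \<Rightarrow> 'a poly fract multiset" where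
  "elementary_divisors P z =
     {# lin_factor z powi k.
        k \<in># filter_mset (\<lambda>k. k \<noteq> 0) (mset (invariant_orders_at (rat_of_poly_mat P) z)) #}"


text \<open>
  A polynomial system matrix is given by its blocks \<open>A\<close>, \<open>B\<close>, \<open>C\<close>, \<open>D\<close>; the lower left block
  of the matrix itself is \<open>- C\<close>.
\<close>

definition polynomial_system ::
  "nat \<Rightarrow> nat \<Rightarrow> nat \<Rightarrow> 'a::field poly mat \<Rightarrow> 'a poly mat \<Rightarrow> 'a poly mat \<Rightarrow> 'a poly mat \<Rightarrow> bool" where
  "polynomial_system n q t A B C D \<longleftrightarrow>
     A \<in> carrier_mat n n \<and> B \<in> carrier_mat n t \<and> C \<in> carrier_mat q n \<and> D \<in> carrier_mat q t \<and>
     (n > 0 \<longrightarrow> det A \<noteq> 0)"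

definition system_matrix ::
  "'a::field poly mat \<Rightarrow> 'a poly mat \<Rightarrow> 'a poly mat \<Rightarrow> 'a poly mat \<Rightarrow> 'a poly mat" where
  "system_matrix A B C D = four_block_mat A B (- C) D"

text \<open>If \<open>A\<close> is the empty matrix, the second summand is a zero matrix.\<close>

definition transfer_function ::
  "'a::field poly mat \<Rightarrow> 'a poly mat \<Rightarrow> 'a poly mat \<Rightarrow> 'a poly mat \<Rightarrow> 'a rat_mat" where
  "transfer_function A B C D =
     rat_of_poly_mat D +
     rat_of_poly_mat C * the (mat_inverse (rat_of_poly_mat A)) * rat_of_poly_mat B"

definition degree_le_one :: "'a::field poly mat \<Rightarrow> bool" where
  "degree_le_one M \<longleftrightarrow> (\<forall>i<dim_row M. \<forall>j<dim_col M. degree (M $$ (i, j)) \<le> 1)"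

definition linear_polynomial_system ::
  "nat \<Rightarrow> nat \<Rightarrow> nat \<Rightarrow> 'a::field poly mat \<Rightarrow> 'a poly mat \<Rightarrow> 'a poly mat \<Rightarrow> 'a poly mat \<Rightarrow> bool" where
  "linear_polynomial_system n q t A B C D \<longleftrightarrow>
     polynomial_system n q t A B C D \<and>
     degree_le_one A \<and> degree_le_one B \<and> degree_le_one C \<and> degree_le_one D"

definition minimal_at ::
  "nat \<Rightarrow> 'a::field poly mat \<Rightarrow> 'a poly mat \<Rightarrow> 'a poly mat \<Rightarrow> 'a \<Rightarrow> bool" where
  "minimal_at n A B C z \<longleftrightarrow>
     (n > 0 \<longrightarrow>
        mat_rank (eval_mat z A @\<^sub>r eval_mat z C) = n \<and>
        mat_rank (side_by_side (eval_mat z A) (eval_mat z B)) = n)"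

definition is_linearization_at ::
  "nat \<Rightarrow> nat \<Rightarrow> nat \<Rightarrow> 'a::field poly mat \<Rightarrow> 'a poly mat \<Rightarrow> 'a poly mat \<Rightarrow> 'a poly mat \<Rightarrow>
   'a rat_mat \<Rightarrow> 'a \<Rightarrow> bool" where
  "is_linearization_at n q t A B C D G z \<longleftrightarrow>
     linear_polynomial_system n q t A B C D \<and>
     minimal_at n A B C z \<and>
     (\<exists>s1 s2 :: nat.
        int s1 - int s2 = int q - int (dim_row G) \<and>
        int s1 - int s2 = int t - int (dim_col G) \<and>
        (\<exists>R1 \<in> carrier_mat (dim_row G + s1) (dim_row G + s1).
         \<exists>R2 \<in> carrier_mat (dim_col G + s1) (dim_col G + s1).
           regular_mat_at R1 z \<and> regular_mat_at R2 z \<and>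
           R1 * diag_one G s1 * R2 = diag_one (transfer_function A B C D) s2))"

text \<open>The matrix pencil \<open>M1 \<lambda> + M0\<close>, where \<open>[:0, 1:]\<close> is the indeterminate \<open>\<lambda>\<close>.\<close>

definition pencil :: "'a::field mat \<Rightarrow> 'a mat \<Rightarrow> 'a poly mat" where
  "pencil M1 M0 = [:0, 1:] \<cdot>\<^sub>m map_mat (\<lambda>c. [:c:]) M1 + map_mat (\<lambda>c. [:c:]) M0"

end

theory Submission
  imports Defs "Jordan_Normal_Form.Column_Operations"
begin

text \<open>
  Work over the local ring of rational functions without pole at \<open>z\<close>, calling two rational matrices
  equivalent if they differ by factors that are invertible over this ring. Every matrix is equivalent
  to a diagonal matrix of powers of the uniformizer, whose exponents (the orders) are determined by
  the equivalence class, and a direct sum has the union of the orders of its summands. If the system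
  matrix \<open>L = [A, B; -C, D]\<close> is minimal at \<open>z\<close>, with transfer function \<open>H\<close>, then the Bezout
  identities \<open>A X + B Y = 1\<close> and \<open>U A + V C = 1\<close> over the local ring yield, by explicit block
  operations, an equivalence of \<open>A\<^sup>-\<^sup>1 \<oplus> 1 \<oplus> L\<close> with \<open>1 \<oplus> 1 \<oplus> H\<close>.
  As \<open>A\<close> and \<open>L\<close> have no negative orders, the negative orders of \<open>H\<close> are those of \<open>A\<close> with sign
  changed and its positive orders are those of \<open>L\<close>. Finally \<open>L\<close> is a linearization of \<open>G\<close> if and
  only if the orders of \<open>H\<close> are those of \<open>G\<close> together with \<open>s\<close> zeros.
\<close>

section \<open>Block matrices and rank\<close>

text \<open>Eliminating with \<open>A\<close> as a pivot would turn \<open>L\<close> into the direct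
  sum of \<open>A\<close> and \<open>H\<close>, but the multipliers involve
  \<open>A\<^sup>-\<^sup>1\<close>, which may have a pole at \<open>z\<close>. The extra summand
  \<open>A\<^sup>-\<^sup>1\<close> removes this obstacle: \<open>L\<close> and
  \<open>A \<oplus> 1\<close> become numerator and denominator of a matrix fraction whose quotient
  \<open>[1, B; -C A\<^sup>-\<^sup>1, D]\<close> has pivot 1 and confines the non-regular part to
  one corner. One Bezout identity makes this fraction coprime, the other clears the corner.
  Elementary divisors do not see the orders equal to 0. Their number is fixed by the total number of
  orders, which is the rank; this is how condition (a) enters. Uniqueness of the orders is obtained
  by counting the exponents at most \<open>t\<close>, for every \<open>t\<close>, and by bounding
  zero blocks of invertible matrices modulo the uniformizer. This avoids minors and determinantal
  divisors.\<close>

definition dsum :: "'b::zero mat \<Rightarrow> 'b mat \<Rightarrow> 'b mat" where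
  "dsum M N = four_block_mat M (0\<^sub>m (dim_row M) (dim_col N)) (0\<^sub>m (dim_row N) (dim_col M)) N"

lemma dsum_carrier [simp, intro]:
  "M \<in> carrier_mat a b \<Longrightarrow> N \<in> carrier_mat c d \<Longrightarrow> dsum M N \<in> carrier_mat (a + c) (b + d)"
  unfolding dsum_def by auto

lemma dsum_mult:
  fixes M :: "'b::semiring_1 mat"
  assumes "M \<in> carrier_mat a b" "N \<in> carrier_mat c d" "M' \<in> carrier_mat b e" "N' \<in> carrier_mat d f"
  shows "dsum M N * dsum M' N' = dsum (M * M') (N * N')"
  using assms unfolding dsum_def
  by (subst mult_four_block_mat[of _ a b _ d _ c _ _ e _ f]) auto

lemma dsum_one: "dsum (1\<^sub>m a) (1\<^sub>m b) = (1\<^sub>m (a + b) :: 'b::semiring_1 mat)"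
  unfolding dsum_def by simp

lemma mat_add_uminus_self:
  fixes U :: "'b::ring mat"
  shows "U \<in> carrier_mat a b \<Longrightarrow> U + - U = 0\<^sub>m a b"
  by (intro eq_matI) auto

lemma mat_uminus_zero: "- 0\<^sub>m a b = (0\<^sub>m a b :: 'b::ring mat)"
  by (intro eq_matI) auto

lemma map2_uminus: "map2 (+) \<nu> (map uminus \<nu>) = replicate (length \<nu>) (0::int)"
  "map2 (+) (map uminus \<nu>) \<nu> = replicate (length \<nu>) (0::int)"
  by (induction \<nu>) auto

lemma map2_zero: "map2 (+) \<nu> (replicate (length \<nu>) (0::int)) = \<nu>"
  by (induction \<nu>) auto

text \<open>Shaped for \<open>eqv_system_matrix\<close>: there \<open>P\<close> is
  \<open>C * X\<close>, \<open>T\<close> is \<open>D * Y\<close>, and the cancelled \<open>S\<close>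
  is the part that contains the inverse of \<open>A\<close>.\<close>

lemma mat_cancel_left:
  fixes P :: "'b::ab_group_add mat"
  assumes "P \<in> carrier_mat a b" "S \<in> carrier_mat a b" "T \<in> carrier_mat a b"
  shows "- (P + S) + (T + S) = T - P"
  using assms by (intro eq_matI) auto

text \<open>A left inverse makes \<open>X\<close> injective, hence its columns independent.
  Distinctness of the columns is a separate step because linear dependence is a property of the set
  of columns.\<close>

lemma mat_rank_left_inverse:
  fixes X :: "'k::field mat"
  assumes X: "X \<in> carrier_mat a r" and L: "L \<in> carrier_mat r a" and LX: "L * X = 1\<^sub>m r"
  shows "mat_rank X = r"
proof -
  have inj: "u = w" if "u \<in> carrier_vec r" "w \<in> carrier_vec r" "X *\<^sub>v u = X *\<^sub>v w" for u w
  proof -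
    have "L * X *\<^sub>v u = L * X *\<^sub>v w"
      using that X L by (simp add: assoc_mult_mat_vec[of _ r a _ r])
    then show ?thesis using that LX by simp
  qed
  have colX: "col X j = X *\<^sub>v unit_vec r j" if "j < r" for j
    using X that by (intro eq_vecI) auto
  have "distinct (cols X)"
  proof (unfold distinct_conv_nth, intro allI impI)
    fix i j assume "i < length (cols X)" "j < length (cols X)" "i \<noteq> j"
    then have ij: "i < r" "j < r" "i \<noteq> j" using X by auto
    have "(unit_vec r i :: 'k vec) \<noteq> unit_vec r j" using ij by simp
    then have "col X i \<noteq> col X j" using inj[of "unit_vec r i" "unit_vec r j"] colX ij by auto
    then show "cols X ! i \<noteq> cols X ! j" using ij X by simp
  qed
  moreover have "\<not> module.lin_dep class_ring (module_vec TYPE('k) a) (set (cols X))"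
  proof
    assume "module.lin_dep class_ring (module_vec TYPE('k) a) (set (cols X))"
    then obtain w where "w \<in> carrier_vec r" "w \<noteq> 0\<^sub>v r" "X *\<^sub>v w = 0\<^sub>v a"
      using vec_space.lin_depE[OF X _ \<open>distinct (cols X)\<close>] by blast
    moreover have "X *\<^sub>v 0\<^sub>v r = 0\<^sub>v a" using X by auto
    ultimately show False using inj[of w "0\<^sub>v r"] by auto
  qed
  ultimately show ?thesis
    using vec_space.lin_indpt_full_rank[OF X] X by (simp add: mat_rank_def)
qed

text \<open>The column spaces coincide, since \<open>X *\<^sub>v x\<close> is also the image of
  \<open>Z *\<^sub>v x\<close> under \<open>X * Y\<close>.\<close>

lemma mat_rank_mult_right_invertible:
  fixes X :: "'k::field mat"
  assumes X: "X \<in> carrier_mat a r" and Y: "Y \<in> carrier_mat r b" and Z: "Z \<in> carrier_mat b r"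
    and YZ: "Y * Z = 1\<^sub>m r"
  shows "mat_rank (X * Y) = mat_rank X"
proof -
  have XY: "X * Y \<in> carrier_mat a b" using X Y by auto
  have "vec_space.col_space a (X * Y) = vec_space.col_space a X"
  proof (intro Set.set_eqI iffI)
    fix y assume "y \<in> vec_space.col_space a (X * Y)"
    then obtain x where "x \<in> carrier_vec b" "y = X * Y *\<^sub>v x"
      unfolding vec_space.col_space_eq[OF XY] using X Y by auto
    then show "y \<in> vec_space.col_space a X"
      unfolding vec_space.col_space_eq[OF X] using X Y
      by (auto simp: assoc_mult_mat_vec[of _ a r _ b] intro!: bexI[of _ "Y *\<^sub>v x"])
  next
    fix y assume "y \<in> vec_space.col_space a X"
    then obtain x where x: "x \<in> carrier_vec r" and y: "y = X *\<^sub>v x"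
      unfolding vec_space.col_space_eq[OF X] using X by auto
    have "X * Y *\<^sub>v (Z *\<^sub>v x) = X *\<^sub>v (Y * Z *\<^sub>v x)"
      using X Y Z x by (simp add: assoc_mult_mat_vec[of _ a r _ b] assoc_mult_mat_vec[of _ r b _ r])
    also have "\<dots> = X *\<^sub>v x" using YZ x X by simp
    finally have "X * Y *\<^sub>v (Z *\<^sub>v x) = y" using y by simp
    moreover have "Z *\<^sub>v x \<in> carrier_vec (dim_col (X * Y))" "y \<in> carrier_vec (dim_row (X * Y))"
      using X Y Z x y by auto
    ultimately show "y \<in> vec_space.col_space a (X * Y)"
      unfolding vec_space.col_space_eq[OF XY] by blast
  qed
  then show ?thesis
    using X Y by (simp add: mat_rank_def vec_space.rank_def vec_space.col_space_def)
qed

section \<open>Equivalence over a valuation ring\<close>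

text \<open>The locale also covers the trivial valuation \<open>R = UNIV\<close>, \<open>\<pi> = 1\<close>, \<open>v = 0\<close>, for which the Smith
  form is the rank normal form over a field.\<close>

locale val_ring =
  fixes R :: "'k::field set" and \<pi> :: 'k and v :: "'k \<Rightarrow> int"
  assumes one_R [simp]: "1 \<in> R"
    and add_R [simp]: "x \<in> R \<Longrightarrow> y \<in> R \<Longrightarrow> x + y \<in> R"
    and mult_R [simp]: "x \<in> R \<Longrightarrow> y \<in> R \<Longrightarrow> x * y \<in> R"
    and uminus_R [simp]: "x \<in> R \<Longrightarrow> - x \<in> R"
    and pi_R [simp]: "\<pi> \<in> R"
    and pi_nz [simp]: "\<pi> \<noteq> 0"
    and unit_part: "x \<noteq> 0 \<Longrightarrow> x * \<pi> powi (- v x) \<in> R \<and> inverse x * \<pi> powi v x \<in> R"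
    and v_nonneg: "x \<in> R \<Longrightarrow> x \<noteq> 0 \<Longrightarrow> v x \<ge> 0"
    and v_mult: "x \<noteq> 0 \<Longrightarrow> y \<noteq> 0 \<Longrightarrow> v (x * y) = v x + v y"
    and v_pi: "x \<noteq> 0 \<Longrightarrow> v (\<pi> powi v x) = v x"
begin

lemma zero_R [simp]: "0 \<in> R"
  using add_R[OF one_R uminus_R[OF one_R]] by simp

lemma sum_R: "(\<And>i. i \<in> A \<Longrightarrow> f i \<in> R) \<Longrightarrow> sum f A \<in> R"
  by (induction A rule: infinite_finite_induct) auto

lemma prod_R: "(\<And>i. i \<in> A \<Longrightarrow> f i \<in> R) \<Longrightarrow> prod f A \<in> R"
  by (induction A rule: infinite_finite_induct) auto

lemma powi_R: "k \<ge> 0 \<Longrightarrow> \<pi> powi k \<in> R"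
proof -
  have "\<pi> ^ n \<in> R" for n by (induction n) auto
  then show "k \<ge> 0 \<Longrightarrow> \<pi> powi k \<in> R" by (simp add: power_int_def)
qed

section \<open>Matrices over the ring and their invertibility\<close>

definition Rmat :: "nat \<Rightarrow> nat \<Rightarrow> 'k mat set" where
  "Rmat a b = {M \<in> carrier_mat a b. \<forall>i<a. \<forall>j<b. M $$ (i, j) \<in> R}"

lemma Rmat_carrier: "M \<in> Rmat a b \<Longrightarrow> M \<in> carrier_mat a b"
  unfolding Rmat_def by auto

lemma Rmat_one [simp]: "1\<^sub>m n \<in> Rmat n n"
  and Rmat_zero [simp]: "0\<^sub>m a b \<in> Rmat a b"
  and Rmat_add: "M \<in> Rmat a b \<Longrightarrow> N \<in> Rmat a b \<Longrightarrow> M + N \<in> Rmat a b"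
  and Rmat_uminus: "M \<in> Rmat a b \<Longrightarrow> - M \<in> Rmat a b"
  unfolding Rmat_def by auto

lemma Rmat_mult: "M \<in> Rmat a b \<Longrightarrow> N \<in> Rmat b c \<Longrightarrow> M * N \<in> Rmat a c"
  unfolding Rmat_def by (auto simp: scalar_prod_def intro!: sum_R)

lemma Rmat_block:
  "A \<in> Rmat a1 b1 \<Longrightarrow> B \<in> Rmat a1 b2 \<Longrightarrow> C \<in> Rmat a2 b1 \<Longrightarrow> D \<in> Rmat a2 b2 \<Longrightarrow>
   four_block_mat A B C D \<in> Rmat (a1 + a2) (b1 + b2)"
  unfolding Rmat_def by auto

text \<open>Invertibility is given by a witness, which is convenient for products and block
  matrices; \<open>GL_iff_det\<close> supplies the link to the determinant, in terms of which
  regularity at a point is defined.\<close>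

definition GL :: "nat \<Rightarrow> 'k mat set" where
  "GL n = {P \<in> Rmat n n. \<exists>P' \<in> Rmat n n. P * P' = 1\<^sub>m n \<and> P' * P = 1\<^sub>m n}"

lemma GLI: "P \<in> Rmat n n \<Longrightarrow> P' \<in> Rmat n n \<Longrightarrow> P * P' = 1\<^sub>m n \<Longrightarrow> P' * P = 1\<^sub>m n \<Longrightarrow> P \<in> GL n"
  unfolding GL_def by auto

lemma GL_carrier: "P \<in> GL n \<Longrightarrow> P \<in> carrier_mat n n"
  unfolding GL_def Rmat_def by auto

lemma GL_inverse:
  assumes "P \<in> GL n"
  obtains P' where "P' \<in> GL n" "P * P' = 1\<^sub>m n" "P' * P = 1\<^sub>m n"
  using assms unfolding GL_def by auto

lemma GL_one [simp]: "1\<^sub>m n \<in> GL n"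
  by (rule GLI[of _ _ "1\<^sub>m n"]) auto

lemma GL_mult:
  assumes P: "P \<in> GL n" and Q: "Q \<in> GL n"
  shows "P * Q \<in> GL n"
proof -
  from P obtain P' where P': "P' \<in> GL n" "P * P' = 1\<^sub>m n" "P' * P = 1\<^sub>m n" by (rule GL_inverse)
  from Q obtain Q' where Q': "Q' \<in> GL n" "Q * Q' = 1\<^sub>m n" "Q' * Q = 1\<^sub>m n" by (rule GL_inverse)
  note c = P[THEN GL_carrier] Q[THEN GL_carrier] P'(1)[THEN GL_carrier] Q'(1)[THEN GL_carrier]
  have "P * Q * (Q' * P') = P * (Q * Q') * P'"
    using c by (simp add: assoc_mult_mat[of _ n n _ n _ n])
  then have 1: "P * Q * (Q' * P') = 1\<^sub>m n" using c P' Q' by simp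
  have "Q' * P' * (P * Q) = Q' * (P' * P) * Q"
    using c by (simp add: assoc_mult_mat[of _ n n _ n _ n])
  then have 2: "Q' * P' * (P * Q) = 1\<^sub>m n" using c P' Q' by simp
  show ?thesis
    by (rule GLI[of _ _ "Q' * P'"]) (use P Q P' Q' 1 2 in \<open>auto simp: GL_def intro!: Rmat_mult\<close>)
qed

lemma GL_dsum:
  assumes P: "P \<in> GL a" and Q: "Q \<in> GL b"
  shows "dsum P Q \<in> GL (a + b)"
proof -
  from P obtain P' where P': "P' \<in> GL a" "P * P' = 1\<^sub>m a" "P' * P = 1\<^sub>m a" by (rule GL_inverse)
  from Q obtain Q' where Q': "Q' \<in> GL b" "Q * Q' = 1\<^sub>m b" "Q' * Q = 1\<^sub>m b" by (rule GL_inverse)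
  note c = P[THEN GL_carrier] Q[THEN GL_carrier] P'(1)[THEN GL_carrier] Q'(1)[THEN GL_carrier]
  have "dsum P Q \<in> Rmat (a + b) (a + b)" "dsum P' Q' \<in> Rmat (a + b) (a + b)"
    using P Q P' Q' c by (auto simp: dsum_def GL_def intro!: Rmat_block)
  then show ?thesis
    by (rule GLI) (use c P' Q' in \<open>simp_all add: dsum_mult[of _ a a _ b b _ a _ b] dsum_one\<close>)
qed

lemma GL_upper: assumes U: "U \<in> Rmat a b"
  shows "four_block_mat (1\<^sub>m a) U (0\<^sub>m b a) (1\<^sub>m b) \<in> GL (a + b)"
proof -
  have c: "U \<in> carrier_mat a b" using U by (rule Rmat_carrier)
  show ?thesis
    by (rule GLI[of _ _ "four_block_mat (1\<^sub>m a) (- U) (0\<^sub>m b a) (1\<^sub>m b)"])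
      (use U c in \<open>auto simp: mat_add_uminus_self mat_uminus_zero mult_four_block_mat[of _ a a _ b _ b _ _ a _ b]
        intro!: Rmat_block Rmat_uminus\<close>)
qed

lemma GL_lower: assumes U: "U \<in> Rmat b a"
  shows "four_block_mat (1\<^sub>m a) (0\<^sub>m a b) U (1\<^sub>m b) \<in> GL (a + b)"
proof -
  have c: "U \<in> carrier_mat b a" using U by (rule Rmat_carrier)
  show ?thesis
    by (rule GLI[of _ _ "four_block_mat (1\<^sub>m a) (0\<^sub>m a b) (- U) (1\<^sub>m b)"])
      (use U c in \<open>auto simp: mat_add_uminus_self mat_uminus_zero mult_four_block_mat[of _ a a _ b _ b _ _ a _ b]
        intro!: Rmat_block Rmat_uminus\<close>)
qed

section \<open>Equivalence and its closure properties\<close>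

definition eqv :: "'k mat \<Rightarrow> 'k mat \<Rightarrow> bool" where
  "eqv M N \<longleftrightarrow> N \<in> carrier_mat (dim_row M) (dim_col M) \<and>
     (\<exists>P \<in> GL (dim_row M). \<exists>Q \<in> GL (dim_col M). M = P * N * Q)"

lemma eqvI: "P \<in> GL a \<Longrightarrow> Q \<in> GL b \<Longrightarrow> N \<in> carrier_mat a b \<Longrightarrow> M = P * N * Q \<Longrightarrow> eqv M N"
proof -
  assume *: "P \<in> GL a" "Q \<in> GL b" "N \<in> carrier_mat a b" "M = P * N * Q"
  then have "dim_row M = a" "dim_col M = b" by (auto dest!: GL_carrier)
  then show "eqv M N" unfolding eqv_def using * by blast
qed

lemma eqvE:
  assumes "eqv M N" "M \<in> carrier_mat a b"
  obtains P Q where "P \<in> GL a" "Q \<in> GL b" "N \<in> carrier_mat a b" "M = P * N * Q"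
  using assms unfolding eqv_def by auto

lemma eqv_carrier: "eqv M N \<Longrightarrow> M \<in> carrier_mat a b \<Longrightarrow> N \<in> carrier_mat a b"
  unfolding eqv_def by auto

lemma eqv_dims: "eqv M N \<Longrightarrow> dim_row N = dim_row M" "eqv M N \<Longrightarrow> dim_col N = dim_col M"
  unfolding eqv_def by auto

lemma eqv_refl [simp]: "eqv M M"
  by (rule eqvI[of "1\<^sub>m (dim_row M)" _ "1\<^sub>m (dim_col M)"]) auto

lemma eqv_left: "P \<in> GL a \<Longrightarrow> N \<in> carrier_mat a b \<Longrightarrow> eqv (P * N) N"
  by (rule eqvI[of P a "1\<^sub>m b" b]) (auto dest!: GL_carrier)

lemma eqv_right: "Q \<in> GL b \<Longrightarrow> N \<in> carrier_mat a b \<Longrightarrow> eqv (N * Q) N"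
  by (rule eqvI[of "1\<^sub>m a" a Q b]) (auto dest!: GL_carrier)

lemma eqv_sym: assumes "eqv M N" shows "eqv N M"
proof -
  define a b where "a = dim_row M" and "b = dim_col M"
  have M: "M \<in> carrier_mat a b" unfolding a_def b_def by auto
  from assms M obtain P Q where PQ: "P \<in> GL a" "Q \<in> GL b" and N: "N \<in> carrier_mat a b"
    and eq: "M = P * N * Q" by (rule eqvE)
  from PQ obtain P' where P': "P' \<in> GL a" "P' * P = 1\<^sub>m a" by (metis GL_inverse)
  from PQ obtain Q' where Q': "Q' \<in> GL b" "Q * Q' = 1\<^sub>m b" by (metis GL_inverse)
  note c = PQ[THEN GL_carrier] P'(1)[THEN GL_carrier] Q'(1)[THEN GL_carrier] N
  have "P' * M * Q' = (P' * P) * N * (Q * Q')"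
    unfolding eq using c
    by (simp add: assoc_mult_mat[of _ a a _ b _ b] assoc_mult_mat[of _ a a _ a _ b]
        assoc_mult_mat[of _ a b _ b _ b] mult_carrier_mat[of _ a b _ b])
  then have "N = P' * M * Q'" using c P' Q' by simp
  then show ?thesis using P' Q' M by (intro eqvI[of P' a Q' b]) auto
qed

lemma eqv_trans [trans]: assumes 1: "eqv M N" and 2: "eqv N L" shows "eqv M L"
proof -
  define a b where "a = dim_row M" and "b = dim_col M"
  have M: "M \<in> carrier_mat a b" unfolding a_def b_def by auto
  from 1 M obtain P Q where PQ: "P \<in> GL a" "Q \<in> GL b" and N: "N \<in> carrier_mat a b"
    and eq: "M = P * N * Q" by (rule eqvE)
  from 2 N obtain S T where ST: "S \<in> GL a" "T \<in> GL b" and L: "L \<in> carrier_mat a b"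
    and eq': "N = S * L * T" by (rule eqvE)
  note c = PQ[THEN GL_carrier] ST[THEN GL_carrier] L
  have "M = (P * S) * L * (T * Q)"
    unfolding eq eq' using c
    by (simp add: assoc_mult_mat[of _ a a _ b _ b] assoc_mult_mat[of _ a a _ a _ b]
        assoc_mult_mat[of _ a b _ b _ b] mult_carrier_mat[of _ a b _ b])
  then show ?thesis using PQ ST L by (intro eqvI[of "P * S" a "T * Q" b]) (auto intro: GL_mult)
qed

lemma eqv_dsum:
  assumes "eqv M M'" "eqv N N'"
  shows "eqv (dsum M N) (dsum M' N')"
proof -
  obtain a b where M: "M \<in> carrier_mat a b" by auto
  obtain c d where N: "N \<in> carrier_mat c d" by auto
  from assms(1) M obtain P Q where PQ: "P \<in> GL a" "Q \<in> GL b" and M': "M' \<in> carrier_mat a b"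
    and eq: "M = P * M' * Q" by (rule eqvE)
  from assms(2) N obtain S T where ST: "S \<in> GL c" "T \<in> GL d" and N': "N' \<in> carrier_mat c d"
    and eq': "N = S * N' * T" by (rule eqvE)
  note c = PQ[THEN GL_carrier] ST[THEN GL_carrier] M' N'
  have "dsum M N = dsum P S * dsum M' N' * dsum Q T"
    unfolding eq eq' using c
    by (simp add: dsum_mult[of _ a a _ c c _ b _ d] dsum_mult[of _ a b _ c d _ b _ d]
        mult_carrier_mat[of _ a a _ b] mult_carrier_mat[of _ c c _ d])
  then show ?thesis using PQ ST M' N'
    by (intro eqvI[of "dsum P S" "a + c" "dsum Q T" "b + d"]) (auto intro: GL_dsum)
qed

text \<open>The scalar may lie outside \<open>R\<close>: elimination scales a matrix into
  \<open>R\<close>, works there and scales back.\<close>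

lemma eqv_smult:
  assumes "eqv M N"
  shows "eqv (c \<cdot>\<^sub>m M) (c \<cdot>\<^sub>m N)"
proof -
  obtain a b where M: "M \<in> carrier_mat a b" by auto
  from assms M obtain P Q where PQ: "P \<in> GL a" "Q \<in> GL b" and N: "N \<in> carrier_mat a b"
    and eq: "M = P * N * Q" by (rule eqvE)
  note cc = PQ[THEN GL_carrier] N
  have "c \<cdot>\<^sub>m M = P * (c \<cdot>\<^sub>m N) * Q"
    unfolding eq using cc
    by (simp add: mult_smult_distrib[of _ a a _ b] mult_smult_assoc_mat[of _ a b _ b])
  then show ?thesis using PQ N by (intro eqvI[of P a Q b]) auto
qed

lemma eqv_Rmat:
  assumes "eqv M N" "N \<in> Rmat a b" shows "M \<in> Rmat a b"
proof -
  have "M \<in> carrier_mat a b"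
    using assms(2)[THEN Rmat_carrier] eqv_carrier[OF eqv_sym[OF assms(1)]] by auto
  with assms(1) obtain P Q where "P \<in> GL a" "Q \<in> GL b" and N: "N \<in> carrier_mat a b"
    and eq: "M = P * N * Q" by (rule eqvE)
  then show ?thesis using assms(2) by (auto simp: GL_def intro!: Rmat_mult)
qed

section \<open>Elementary block operations\<close>

context
  fixes A B C D :: "'k mat" and a1 a2 b1 b2 :: nat
  assumes A: "A \<in> carrier_mat a1 b1" and B: "B \<in> carrier_mat a1 b2"
    and C: "C \<in> carrier_mat a2 b1" and D: "D \<in> carrier_mat a2 b2"
begin

text \<open>Only the multiplier \<open>U\<close> has to be regular, the four blocks are arbitrary.
  This lets a block such as the inverse of \<open>A\<close> take part in the operations.\<close>

lemma eqv_row_upper: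
  assumes U: "U \<in> Rmat a1 a2"
  shows "eqv (four_block_mat A B C D) (four_block_mat (A + U * C) (B + U * D) C D)"
proof -
  let ?E = "four_block_mat (1\<^sub>m a1) U (0\<^sub>m a2 a1) (1\<^sub>m a2)"
  have "?E * four_block_mat A B C D = four_block_mat (A + U * C) (B + U * D) C D"
    using A B C D U[THEN Rmat_carrier]
    by (subst mult_four_block_mat[of _ a1 a1 _ a2 _ a2 _ _ b1 _ b2]) auto
  with eqv_left[OF GL_upper[OF U], of "four_block_mat A B C D" "b1 + b2"] A D
  show ?thesis by (auto intro: eqv_sym)
qed

lemma eqv_row_lower:
  assumes U: "U \<in> Rmat a2 a1"
  shows "eqv (four_block_mat A B C D) (four_block_mat A B (C + U * A) (D + U * B))"
proof -
  let ?E = "four_block_mat (1\<^sub>m a1) (0\<^sub>m a1 a2) U (1\<^sub>m a2)"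
  have "?E * four_block_mat A B C D = four_block_mat A B (U * A + C) (U * B + D)"
    using A B C D U[THEN Rmat_carrier]
    by (subst mult_four_block_mat[of _ a1 a1 _ a2 _ a2 _ _ b1 _ b2]) auto
  moreover have "U * A + C = C + U * A" "U * B + D = D + U * B"
    using A B C D U[THEN Rmat_carrier]
    by (simp_all add: comm_add_mat[of C a2 b1] comm_add_mat[of D a2 b2])
  ultimately show ?thesis
    using eqv_left[OF GL_lower[OF U], of "four_block_mat A B C D" "b1 + b2"] A D
    by (auto intro: eqv_sym)
qed

lemma eqv_col_right:
  assumes U: "U \<in> Rmat b1 b2"
  shows "eqv (four_block_mat A B C D) (four_block_mat A (B + A * U) C (D + C * U))"
proof -
  let ?E = "four_block_mat (1\<^sub>m b1) U (0\<^sub>m b2 b1) (1\<^sub>m b2)"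
  have "four_block_mat A B C D * ?E = four_block_mat A (A * U + B) C (C * U + D)"
    using A B C D U[THEN Rmat_carrier]
    by (subst mult_four_block_mat[of _ a1 b1 _ b2 _ a2 _ _ b1 _ b2]) auto
  moreover have "A * U + B = B + A * U" "C * U + D = D + C * U"
    using A B C D U[THEN Rmat_carrier]
    by (simp_all add: comm_add_mat[of B a1 b2] comm_add_mat[of D a2 b2])
  ultimately show ?thesis
    using eqv_right[OF GL_upper[OF U], of "four_block_mat A B C D" "a1 + a2"] A D
    by (auto intro: eqv_sym)
qed

lemma eqv_col_left:
  assumes U: "U \<in> Rmat b2 b1"
  shows "eqv (four_block_mat A B C D) (four_block_mat (A + B * U) B (C + D * U) D)"
proof -
  let ?E = "four_block_mat (1\<^sub>m b1) (0\<^sub>m b1 b2) U (1\<^sub>m b2)"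
  have "four_block_mat A B C D * ?E = four_block_mat (A + B * U) B (C + D * U) D"
    using A B C D U[THEN Rmat_carrier]
    by (subst mult_four_block_mat[of _ a1 b1 _ b2 _ a2 _ _ b1 _ b2]) auto
  with eqv_right[OF GL_lower[OF U], of "four_block_mat A B C D" "a1 + a2"] A D
  show ?thesis by (auto intro: eqv_sym)
qed

end

text \<open>With an identity as pivot the clearing multipliers are \<open>- B\<close> and
  \<open>- C\<close>, which are regular; \<open>D\<close> is replaced by the Schur
  complement.\<close>

lemma eqv_unit_pivot:
  assumes B: "B \<in> Rmat a b" and C: "C \<in> Rmat c a" and D: "D \<in> carrier_mat c b"
  shows "eqv (four_block_mat (1\<^sub>m a) B C D) (dsum (1\<^sub>m a) (D - C * B))"
proof -
  note car = B[THEN Rmat_carrier] C[THEN Rmat_carrier] D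
  have "eqv (four_block_mat (1\<^sub>m a) B C D)
    (four_block_mat (1\<^sub>m a) (B + 1\<^sub>m a * (- B)) C (D + C * (- B)))"
    using car B by (intro eqv_col_right[of _ a a]) (auto intro: Rmat_uminus)
  moreover have "B + 1\<^sub>m a * (- B) = 0\<^sub>m a b" "D + C * (- B) = D - C * B"
    using car by (auto simp: mat_add_uminus_self add_uminus_minus_mat[of _ c b])
  moreover have "eqv (four_block_mat (1\<^sub>m a) (0\<^sub>m a b) C (D - C * B))
    (four_block_mat (1\<^sub>m a) (0\<^sub>m a b) (C + (- C) * 1\<^sub>m a) ((D - C * B) + (- C) * 0\<^sub>m a b))"
    using car C by (intro eqv_row_lower[of _ a a]) (auto intro: Rmat_uminus)
  moreover have "C + (- C) * 1\<^sub>m a = 0\<^sub>m c a" "(D - C * B) + (- C) * 0\<^sub>m a b = D - C * B"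
    using car by (auto simp: mat_add_uminus_self)
  ultimately show ?thesis
    using car unfolding dsum_def by (auto intro: eqv_trans)
qed

section \<open>Determinants over the ring\<close>

lemma Rmat_det: assumes "M \<in> Rmat n n" shows "det M \<in> R"
proof -
  have "signof p * x \<in> R" if "x \<in> R" for p :: "nat \<Rightarrow> nat" and x
    using that by (auto simp: sign_def)
  moreover have "(\<Prod>i = 0..<n. M $$ (i, p i)) \<in> R" if p: "p permutes {0..<n}" for p
  proof (rule prod_R)
    fix i assume "i \<in> {0..<n}"
    then show "M $$ (i, p i) \<in> R"
      using assms permutes_in_image[OF p, of i] by (auto simp: Rmat_def)
  qed
  ultimately show ?thesis
    unfolding det_def'[OF Rmat_carrier[OF assms]] by (intro sum_R) auto
qed

lemma Rmat_adj_mat: assumes M: "M \<in> Rmat n n" shows "adj_mat M \<in> Rmat n n"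
proof -
  have "cofactor M i j \<in> R" if "i < n" "j < n" for i j
  proof -
    have "mat_delete M i j \<in> Rmat (n - 1) (n - 1)"
      using M that unfolding mat_delete_def Rmat_def by (auto simp: mat_delete_def)
    then have "det (mat_delete M i j) \<in> R" by (rule Rmat_det)
    moreover have "(- 1) ^ k \<in> R" for k :: nat by (induction k) auto
    ultimately show ?thesis unfolding cofactor_def by simp
  qed
  then show ?thesis using M unfolding adj_mat_def Rmat_def by auto
qed

text \<open>Cramer's rule: cofactors of a regular matrix are regular, so
  \<open>u \<cdot>\<^sub>m adj_mat M\<close> is a regular inverse whenever \<open>u\<close> inverts
  the determinant in \<open>R\<close>.\<close>

lemma GL_iff_det:
  assumes M: "M \<in> Rmat n n"
  shows "M \<in> GL n \<longleftrightarrow> (\<exists>u \<in> R. det M * u = 1)"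
proof
  assume "M \<in> GL n"
  then obtain M' where M': "M' \<in> GL n" "M * M' = 1\<^sub>m n" by (rule GL_inverse)
  then have "M' \<in> Rmat n n" by (simp add: GL_def)
  then have "det M' \<in> R" "det M * det M' = 1"
    using M' M det_mult[of M n M'] by (auto simp: Rmat_det Rmat_carrier)
  then show "\<exists>u \<in> R. det M * u = 1" by blast
next
  assume "\<exists>u \<in> R. det M * u = 1"
  then obtain u where u: "u \<in> R" "det M * u = 1" by blast
  note adj = adj_mat[OF M[THEN Rmat_carrier]]
  have "u * det M = 1" using u by (simp add: mult.commute)
  then have "u \<cdot>\<^sub>m (det M \<cdot>\<^sub>m 1\<^sub>m n) = 1\<^sub>m n" by (intro eq_matI) auto
  then have "M * (u \<cdot>\<^sub>m adj_mat M) = 1\<^sub>m n" "u \<cdot>\<^sub>m adj_mat M * M = 1\<^sub>m n"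
    using adj M[THEN Rmat_carrier]
    by (simp_all add: mult_smult_distrib[of _ n n _ n] mult_smult_assoc_mat[of _ n n _ n])
  moreover have "u \<cdot>\<^sub>m adj_mat M \<in> Rmat n n"
    using Rmat_adj_mat[OF M] u by (auto simp: Rmat_def)
  ultimately show "M \<in> GL n" using M by (intro GLI)
qed

section \<open>Smith form and rank\<close>

definition pow_diag :: "nat \<Rightarrow> nat \<Rightarrow> int list \<Rightarrow> 'k mat" where
  "pow_diag a b \<nu> = mat a b (\<lambda>(i, j). if i = j \<and> i < length \<nu> then \<pi> powi (\<nu> ! i) else 0)"

lemma pow_diag_carrier [simp]: "pow_diag a b \<nu> \<in> carrier_mat a b"
  and pow_diag_index [simp]: "i < a \<Longrightarrow> j < b \<Longrightarrow>
    pow_diag a b \<nu> $$ (i, j) = (if i = j \<and> i < length \<nu> then \<pi> powi (\<nu> ! i) else 0)"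
  and pow_diag_dim [simp]: "dim_row (pow_diag a b \<nu>) = a" "dim_col (pow_diag a b \<nu>) = b"
  unfolding pow_diag_def by auto

lemma GL_swaprows_mat: "k < n \<Longrightarrow> l < n \<Longrightarrow> swaprows_mat n k l \<in> GL n"
  by (rule GLI[of _ _ "swaprows_mat n k l"])
    (auto simp: swaprows_mat_inv[of l n k] swaprows_mat_inv[of k n l] Rmat_def)

text \<open>Up to a factor in \<open>R\<close>, \<open>x\<close> is \<open>\<pi> powi v x\<close>,
  so the power left over has exponent \<open>v x - k\<close>. The bound is guarded by
  \<open>x \<noteq> 0\<close> because the locale does not constrain \<open>v 0\<close>.\<close>

lemma scale_R:
  assumes "x \<noteq> 0 \<Longrightarrow> k \<le> v x"
  shows "\<pi> powi (- k) * x \<in> R"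
proof (cases "x = 0")
  case False
  have "\<pi> powi (- k) = \<pi> powi (- v x) * \<pi> powi (v x - k)"
    by (simp flip: power_int_add)
  then have "\<pi> powi (- k) * x = (x * \<pi> powi (- v x)) * \<pi> powi (v x - k)"
    by (simp add: ac_simps)
  moreover have "\<dots> \<in> R" using unit_part[OF False] powi_R[of "v x - k"] assms False by simp
  ultimately show ?thesis by metis
qed simp

text \<open>Gaussian elimination in which the pivot is always an entry of least valuation, so that all
  other entries are multiples of it; this also makes the exponents come out sorted.\<close>

lemma smith_form_bounded:
  assumes "M \<in> carrier_mat a b"
    and "\<And>i j. i < a \<Longrightarrow> j < b \<Longrightarrow> M $$ (i, j) \<noteq> 0 \<Longrightarrow> k \<le> v (M $$ (i, j))"
  shows "\<exists>\<nu>. sorted \<nu> \<and> length \<nu> \<le> min a b \<and> (\<forall>x \<in> set \<nu>. k \<le> x) \<and> eqv M (pow_diag a b \<nu>)"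
  using assms
proof (induction a arbitrary: M b k)
  case 0
  then have "M = pow_diag 0 b []" by auto
  then show ?case by (intro exI[of _ "[]"]) auto
next
  case (Suc a M b0 k0)
  show ?case
  proof (cases "\<forall>i<Suc a. \<forall>j<b0. M $$ (i, j) = 0")
    case True
    then have "M = pow_diag (Suc a) b0 []" using Suc.prems by auto
    then show ?thesis by (intro exI[of _ "[]"]) auto
  next
    case False
    define I where "I = {(i, j). i < Suc a \<and> j < b0 \<and> M $$ (i, j) \<noteq> 0}"
    have "finite I" by (rule finite_subset[of _ "{..<Suc a} \<times> {..<b0}"]) (auto simp: I_def)
    moreover have "I \<noteq> {}" using False by (auto simp: I_def)
    ultimately obtain ij where ij: "ij \<in> I" "\<And>y. y \<in> I \<Longrightarrow> v (M $$ ij) \<le> v (M $$ y)"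
      using arg_min_if_finite(1)[of I "\<lambda>y. v (M $$ y)"] arg_min_least[of I _ "\<lambda>y. v (M $$ y)"]
      by blast
    obtain i0 j0 where "ij = (i0, j0)" by force
    with ij have i0: "i0 < Suc a" "j0 < b0" "M $$ (i0, j0) \<noteq> 0"
      and least: "\<And>i j. i < Suc a \<Longrightarrow> j < b0 \<Longrightarrow> M $$ (i, j) \<noteq> 0 \<Longrightarrow> v (M $$ (i0, j0)) \<le> v (M $$ (i, j))"
      by (auto simp: I_def)
    obtain b where b0: "b0 = Suc b" using i0 by (cases b0) auto
    define k where "k = v (M $$ (i0, j0))"
    define M1 where "M1 = swapcols 0 j0 (swaprows 0 i0 M)"
    have M1c: "M1 \<in> carrier_mat (Suc a) (Suc b)" using Suc.prems(1) by (simp add: M1_def b0)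
    have "eqv M1 (swaprows 0 i0 M)"
      unfolding M1_def using Suc.prems(1) i0
      by (subst swapcols_mat[of _ "Suc a" b0]) (auto intro!: eqv_right[of _ b0 _ "Suc a"] GL_swaprows_mat)
    also have "eqv (swaprows 0 i0 M) M"
      using Suc.prems(1) i0
      by (subst swaprows_mat[of _ "Suc a" b0]) (auto intro!: eqv_left[of _ "Suc a" _ b0] GL_swaprows_mat)
    finally have eqM1: "eqv M M1" by (rule eqv_sym)
    have M1_least: "M1 $$ (i, j) \<noteq> 0 \<Longrightarrow> k \<le> v (M1 $$ (i, j))" if "i < Suc a" "j < Suc b" for i j
      using that Suc.prems(1) i0 least unfolding M1_def k_def b0 by auto
    have M100: "M1 $$ (0, 0) = M $$ (i0, j0)"
      using Suc.prems(1) i0 unfolding M1_def b0 by auto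
    \<comment> \<open>Dividing by the power of \<open>\<pi>\<close> that belongs to the pivot makes
      every entry regular and turns the pivot into a unit \<open>u\<close> of
      \<open>R\<close>.\<close>
    define M2 where "M2 = \<pi> powi (- k) \<cdot>\<^sub>m M1"
    have M2R: "M2 \<in> Rmat (Suc a) (Suc b)"
      unfolding Rmat_def M2_def using M1c M1_least by (auto intro!: scale_R)
    define u where "u = M2 $$ (0, 0)"
    have u: "u = \<pi> powi (- k) * M $$ (i0, j0)"
      unfolding u_def M2_def using M1c M100 by simp
    have u_nz: "u \<noteq> 0" using i0 u by simp
    have "inverse u = inverse (M $$ (i0, j0)) * \<pi> powi v (M $$ (i0, j0))"
      unfolding u by (simp add: k_def power_int_minus mult.commute)
    then have uR: "inverse u \<in> R" using unit_part[OF i0(3)] by simp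
    define B where "B = mat 1 b (\<lambda>(i, j). inverse u * M2 $$ (0, Suc j))"
    define C where "C = mat a 1 (\<lambda>(i, j). M2 $$ (Suc i, 0))"
    define D where "D = mat a b (\<lambda>(i, j). M2 $$ (Suc i, Suc j))"
    have BR: "B \<in> Rmat 1 b" and CR: "C \<in> Rmat a 1" and DR: "D \<in> Rmat a b"
      using M2R uR unfolding B_def C_def D_def Rmat_def by auto
    have uGL: "mat 1 1 (\<lambda>_. inverse u) \<in> GL 1"
    proof (rule GLI[of _ _ "mat 1 1 (\<lambda>_. u)"])
      show "mat 1 1 (\<lambda>_. inverse u) \<in> Rmat 1 1" "mat 1 1 (\<lambda>_. u) \<in> Rmat 1 1"
        using uR M2R unfolding Rmat_def u_def by auto
      show "mat 1 1 (\<lambda>_. inverse u) * mat 1 1 (\<lambda>_. u) = 1\<^sub>m 1"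
        "mat 1 1 (\<lambda>_. u) * mat 1 1 (\<lambda>_. inverse u) = 1\<^sub>m 1"
        using u_nz by (auto simp: scalar_prod_def)
    qed
    have c: "B \<in> carrier_mat 1 b" "C \<in> carrier_mat a 1" "D \<in> carrier_mat a b"
      "mat 1 1 (\<lambda>_. inverse u) \<in> carrier_mat 1 1"
      unfolding B_def C_def D_def by auto
    have M2c: "M2 \<in> carrier_mat (1 + a) (1 + b)" using M2R[THEN Rmat_carrier] by simp
    have "dsum (mat 1 1 (\<lambda>_. inverse u)) (1\<^sub>m a) * M2 = four_block_mat (1\<^sub>m 1) B C D"
    proof -
      have "M2 = four_block_mat (mat 1 1 (\<lambda>_. u)) (mat 1 b (\<lambda>(i, j). M2 $$ (0, Suc j))) C D"
        using M2c by (intro eq_matI) (auto simp: u_def C_def D_def)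
      then have "dsum (mat 1 1 (\<lambda>_. inverse u)) (1\<^sub>m a) * M2 =
        dsum (mat 1 1 (\<lambda>_. inverse u)) (1\<^sub>m a) *
          four_block_mat (mat 1 1 (\<lambda>_. u)) (mat 1 b (\<lambda>(i, j). M2 $$ (0, Suc j))) C D"
        by simp
      also have "\<dots> = four_block_mat (1\<^sub>m 1) B C D"
        unfolding dsum_def using c u_nz
        apply (subst mult_four_block_mat[of _ 1 1 _ a _ a _ _ 1 _ b])
        apply auto
        apply (intro cong_four_block_mat eq_matI)
        by (auto simp: B_def scalar_prod_def)
      finally show ?thesis .
    qed
    moreover have "dsum (mat 1 1 (\<lambda>_. inverse u)) (1\<^sub>m a) \<in> GL (1 + a)"
      by (intro GL_dsum uGL GL_one)
    ultimately have "eqv M2 (four_block_mat (1\<^sub>m 1) B C D)"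
      using eqv_left[OF _ M2c, THEN eqv_sym] by metis
    also have "eqv \<dots> (dsum (1\<^sub>m 1) (D - C * B))"
      by (rule eqv_unit_pivot[OF BR CR c(3)])
    finally have eqM2: "eqv M2 (dsum (1\<^sub>m 1) (D - C * B))" .
    define S where "S = D - C * B"
    have SR: "S \<in> Rmat a b"
      unfolding S_def using Rmat_add[OF DR Rmat_uminus[OF Rmat_mult[OF CR BR]]] c
      by (simp add: add_uminus_minus_mat[of _ a b])
    have Sc: "S \<in> carrier_mat a b" using SR by (rule Rmat_carrier)
    have "M1 = \<pi> powi k \<cdot>\<^sub>m M2"
      unfolding M2_def using M1c by (intro eq_matI) (auto simp: power_int_minus)
    then have "eqv M1 (\<pi> powi k \<cdot>\<^sub>m dsum (1\<^sub>m 1) S)"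
      using eqv_smult[OF eqM2, of "\<pi> powi k"] by (simp add: S_def)
    also have "\<pi> powi k \<cdot>\<^sub>m dsum (1\<^sub>m 1) S = dsum (\<pi> powi k \<cdot>\<^sub>m 1\<^sub>m 1) (\<pi> powi k \<cdot>\<^sub>m S)"
      using Sc unfolding dsum_def by (intro eq_matI) auto
    finally have eqM1': "eqv M1 (dsum (\<pi> powi k \<cdot>\<^sub>m 1\<^sub>m 1) (\<pi> powi k \<cdot>\<^sub>m S))" .
    \<comment> \<open>As \<open>S\<close> is regular, scaling it back yields entries of valuation at
      least \<open>k\<close>. The induction hypothesis therefore returns exponents bounded below by
      \<open>k\<close>, and prepending \<open>k\<close> keeps the list sorted.\<close>
    have "\<exists>\<nu>. sorted \<nu> \<and> length \<nu> \<le> min a b \<and> (\<forall>x \<in> set \<nu>. k \<le> x) \<and>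
        eqv (\<pi> powi k \<cdot>\<^sub>m S) (pow_diag a b \<nu>)"
    proof (rule Suc.IH)
      show "\<pi> powi k \<cdot>\<^sub>m S \<in> carrier_mat a b" using Sc by auto
      fix i j assume ij: "i < a" "j < b" "(\<pi> powi k \<cdot>\<^sub>m S) $$ (i, j) \<noteq> 0"
      then have s: "S $$ (i, j) \<noteq> 0" "S $$ (i, j) \<in> R" using SR Sc by (auto simp: Rmat_def)
      have "v (\<pi> powi k * S $$ (i, j)) = k + v (S $$ (i, j))"
        using v_mult[of "\<pi> powi k", OF _ s(1)] v_pi[OF i0(3)] unfolding k_def by simp
      then show "k \<le> v ((\<pi> powi k \<cdot>\<^sub>m S) $$ (i, j))"
        using v_nonneg[OF s(2,1)] ij Sc by auto
    qed
    then obtain \<nu> where \<nu>: "sorted \<nu>" "length \<nu> \<le> min a b" "\<forall>x \<in> set \<nu>. k \<le> x"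
      "eqv (\<pi> powi k \<cdot>\<^sub>m S) (pow_diag a b \<nu>)" by blast
    have "eqv M (dsum (\<pi> powi k \<cdot>\<^sub>m 1\<^sub>m 1) (pow_diag a b \<nu>))"
      using eqM1 eqM1' eqv_dsum[OF eqv_refl \<nu>(4)] by (blast intro: eqv_trans)
    also have "dsum (\<pi> powi k \<cdot>\<^sub>m 1\<^sub>m 1) (pow_diag a b \<nu>) = pow_diag (Suc a) (Suc b) (k # \<nu>)"
      unfolding dsum_def by (intro eq_matI) (auto simp: nth_Cons split: nat.split)
    finally have "eqv M (pow_diag (Suc a) b0 (k # \<nu>))" by (simp add: b0)
    moreover have "k0 \<le> k" using Suc.prems(2) i0 unfolding k_def by blast
    ultimately show ?thesis using \<nu> by (intro exI[of _ "k # \<nu>"]) (auto simp: b0)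
  qed
qed

lemma smith_form:
  assumes M: "M \<in> carrier_mat a b"
  obtains \<nu> where "sorted \<nu>" "length \<nu> \<le> min a b" "eqv M (pow_diag a b \<nu>)"
proof -
  \<comment> \<open>The inserted 0 keeps \<open>Min\<close> well defined for empty matrices. Any
    lower bound serves, so zero entries may contribute an arbitrary value.\<close>
  define k where "k = Min (insert 0 ((\<lambda>(i, j). v (M $$ (i, j))) ` ({..<a} \<times> {..<b})))"
  have "k \<le> v (M $$ (i, j))" if "i < a" "j < b" for i j
    unfolding k_def using that by (intro Min_le) auto
  with smith_form_bounded[OF M, of k] that show ?thesis by blast
qed

lemma pow_diag_mult:
  assumes "length \<nu> = length \<mu>" "length \<nu> \<le> c"
  shows "pow_diag a c \<nu> * pow_diag c b \<mu> = pow_diag a b (map2 (+) \<nu> \<mu>)"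
proof (intro eq_matI)
  fix i j assume "i < dim_row (pow_diag a b (map2 (+) \<nu> \<mu>))" "j < dim_col (pow_diag a b (map2 (+) \<nu> \<mu>))"
  then have ij: "i < a" "j < b" by auto
  have "(pow_diag a c \<nu> * pow_diag c b \<mu>) $$ (i, j) = (\<Sum>k\<in>{0..<c}. pow_diag a c \<nu> $$ (i, k) * pow_diag c b \<mu> $$ (k, j))"
    using ij by (simp add: scalar_prod_def)
  also have "\<dots> = (\<Sum>k\<in>{0..<c}. if i = k then (if i = j \<and> i < length \<nu>
      then \<pi> powi (\<nu> ! i) * \<pi> powi (\<mu> ! i) else 0) else 0)"
    using ij assms by (intro sum.cong) auto
  also have "\<dots> = pow_diag a b (map2 (+) \<nu> \<mu>) $$ (i, j)"
    using ij assms by (auto simp: power_int_add)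
  finally show "(pow_diag a c \<nu> * pow_diag c b \<mu>) $$ (i, j) = pow_diag a b (map2 (+) \<nu> \<mu>) $$ (i, j)" .
qed auto

lemma pow_diag_one: "pow_diag n n (replicate n 0) = 1\<^sub>m n"
  by (intro eq_matI) auto

text \<open>A rank factorization: the diagonal is cut at width \<open>r\<close>, so that
  \<open>M\<close> is a product of a matrix with a left inverse and a matrix with a right inverse.
  Exponent lists \<open>?Z\<close> of zeros encode the rectangular identities.\<close>

lemma mat_rank_eqv_pow_diag:
  assumes M: "M \<in> carrier_mat a b" and len: "length \<nu> \<le> min a b" and eq: "eqv M (pow_diag a b \<nu>)"
  shows "mat_rank M = length \<nu>"
proof -
  define r where "r = length \<nu>"
  from eq M obtain P Q where PQ: "P \<in> GL a" "Q \<in> GL b" and M_eq: "M = P * pow_diag a b \<nu> * Q"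
    by (rule eqvE)
  from PQ obtain P' where P': "P' \<in> GL a" "P' * P = 1\<^sub>m a" by (metis GL_inverse)
  from PQ obtain Q' where Q': "Q' \<in> GL b" "Q * Q' = 1\<^sub>m b" by (metis GL_inverse)
  note c = PQ[THEN GL_carrier] P'(1)[THEN GL_carrier] Q'(1)[THEN GL_carrier]
  let ?Z = "replicate r (0::int)"
  have "pow_diag a b \<nu> = pow_diag a r \<nu> * pow_diag r b ?Z"
    by (subst pow_diag_mult) (auto simp: r_def map2_zero)
  then have M_eq': "M = (P * pow_diag a r \<nu>) * (pow_diag r b ?Z * Q)"
    unfolding M_eq using c
    by (simp add: assoc_mult_mat[of _ a a _ r _ b] assoc_mult_mat[of _ a r _ b _ b]
        assoc_mult_mat[of _ a a _ b _ b] mult_carrier_mat[of _ a r _ b] mult_carrier_mat[of _ r b _ b])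
  have "mat_rank M = mat_rank (P * pow_diag a r \<nu>)"
    unfolding M_eq'
  proof (rule mat_rank_mult_right_invertible)
    show "P * pow_diag a r \<nu> \<in> carrier_mat a r" "pow_diag r b ?Z * Q \<in> carrier_mat r b"
      "Q' * pow_diag b r ?Z \<in> carrier_mat b r" using c by auto
    have "pow_diag r b ?Z * Q * (Q' * pow_diag b r ?Z) = pow_diag r b ?Z * (Q * Q') * pow_diag b r ?Z"
      using c by (simp add: assoc_mult_mat[of _ r b _ b _ r] assoc_mult_mat[of _ r b _ b _ b]
        assoc_mult_mat[of _ b b _ b _ r] mult_carrier_mat[of _ b b _ r])
    also have "\<dots> = pow_diag r b ?Z * pow_diag b r ?Z" using Q' by (simp add: right_mult_one_mat[of _ r b])
    also have "\<dots> = 1\<^sub>m r" using len by (subst pow_diag_mult) (auto simp: r_def map2_zero[of "replicate _ _", simplified] pow_diag_one)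
    finally show "pow_diag r b ?Z * Q * (Q' * pow_diag b r ?Z) = 1\<^sub>m r" .
  qed
  also have "\<dots> = r"
  proof (rule mat_rank_left_inverse)
    show "P * pow_diag a r \<nu> \<in> carrier_mat a r" "pow_diag r a (map uminus \<nu>) * P' \<in> carrier_mat r a"
      using c by auto
    have "pow_diag r a (map uminus \<nu>) * P' * (P * pow_diag a r \<nu>) = pow_diag r a (map uminus \<nu>) * (P' * P) * pow_diag a r \<nu>"
      using c by (simp add: assoc_mult_mat[of _ r a _ a _ r] assoc_mult_mat[of _ r a _ a _ a]
        assoc_mult_mat[of _ a a _ a _ r] mult_carrier_mat[of _ a a _ r])
    also have "\<dots> = pow_diag r a (map uminus \<nu>) * pow_diag a r \<nu>" using P' by (simp add: right_mult_one_mat[of _ r a])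
    also have "\<dots> = 1\<^sub>m r" using len by (subst pow_diag_mult) (auto simp: r_def map2_uminus pow_diag_one)
    finally show "pow_diag r a (map uminus \<nu>) * P' * (P * pow_diag a r \<nu>) = 1\<^sub>m r" .
  qed
  finally show ?thesis by (simp add: r_def)
qed

section \<open>Coprime fractions and system matrices\<close>

text \<open>Since \<open>X D + Y N = 1\<close> gives \<open>D\<^sup>-\<^sup>1 = X + Y (N D\<^sup>-\<^sup>1)\<close>, the non-regular block
  \<open>D\<^sup>-\<^sup>1\<close> can be cleared by a regular row operation once \<open>N D\<^sup>-\<^sup>1\<close> is present.\<close>

lemma eqv_coprime_fraction:
  assumes N: "N \<in> Rmat q k" and Dn: "Dn \<in> Rmat k k" and Di: "Di \<in> carrier_mat k k"
    and inv: "Dn * Di = 1\<^sub>m k" "Di * Dn = 1\<^sub>m k"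
    and X: "X \<in> Rmat k k" and Y: "Y \<in> Rmat k q" and bezout: "X * Dn + Y * N = 1\<^sub>m k"
  shows "eqv (dsum Di N) (dsum (1\<^sub>m k) (N * Di))"
proof -
  note c = N[THEN Rmat_carrier] Dn[THEN Rmat_carrier] Di X[THEN Rmat_carrier] Y[THEN Rmat_carrier]
  have "(X * Dn + Y * N) * Di = X * (Dn * Di) + Y * (N * Di)"
    using c by (simp add: add_mult_distrib_mat[of _ k k] assoc_mult_mat[of _ k k _ k _ k]
        assoc_mult_mat[of _ k q _ k _ k])
  then have Di_eq: "Di = X + Y * (N * Di)"
    using bezout inv c by simp
  have "dsum Di N = four_block_mat Di (0\<^sub>m k k) (0\<^sub>m q k) N"
    unfolding dsum_def using c by (simp add: carrier_matD)
  \<comment> \<open>Adding the first block column times the regular \<open>Dn\<close> to the second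
    one creates an identity block out of the possibly non-regular \<open>Di\<close>.\<close>
  moreover have "eqv (four_block_mat Di (0\<^sub>m k k) (0\<^sub>m q k) N)
    (four_block_mat Di (0\<^sub>m k k + Di * Dn) (0\<^sub>m q k) (N + 0\<^sub>m q k * Dn))"
    using c Dn by (intro eqv_col_right) auto
  moreover have "0\<^sub>m k k + Di * Dn = 1\<^sub>m k" "N + 0\<^sub>m q k * Dn = N" using c inv by auto
  \<comment> \<open>That identity cancels \<open>N\<close> and leaves the fraction
    \<open>N * Di\<close>, with a sign, below \<open>Di\<close>.\<close>
  moreover have "eqv (four_block_mat Di (1\<^sub>m k) (0\<^sub>m q k) N)
    (four_block_mat Di (1\<^sub>m k) (0\<^sub>m q k + (- N) * Di) (N + (- N) * 1\<^sub>m k))"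
    using c N by (intro eqv_row_lower[of _ k k _ k _ q]) (auto intro: Rmat_uminus)
  moreover have "0\<^sub>m q k + (- N) * Di = - (N * Di)" "N + (- N) * 1\<^sub>m k = 0\<^sub>m q k"
    using c by (auto simp: mat_add_uminus_self)
  \<comment> \<open>By \<open>Di_eq\<close>, adding \<open>Y\<close> times the lower row reduces
    \<open>Di\<close> to the regular \<open>X\<close>, so that \<open>- X\<close> becomes an
    admissible multiplier for the next operation.\<close>
  moreover have "eqv (four_block_mat Di (1\<^sub>m k) (- (N * Di)) (0\<^sub>m q k))
    (four_block_mat (Di + Y * (- (N * Di))) (1\<^sub>m k + Y * 0\<^sub>m q k) (- (N * Di)) (0\<^sub>m q k))"
    using c Y by (intro eqv_row_upper) auto
  moreover have "Di + Y * (- (N * Di)) = X"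
  proof -
    have "Di + Y * (- (N * Di)) = X + Y * (N * Di) + - (Y * (N * Di))"
      using c by (subst Di_eq) simp
    also have "\<dots> = X + (Y * (N * Di) + - (Y * (N * Di)))"
      using c by (intro assoc_add_mat[of _ k k]) auto
    also have "\<dots> = X" using c by (simp add: mat_add_uminus_self[of _ k k] mult_carrier_mat[of _ k q _ k] mult_carrier_mat[of _ q k _ k])
    finally show ?thesis .
  qed
  moreover have "1\<^sub>m k + Y * 0\<^sub>m q k = 1\<^sub>m k" using c by auto
  moreover have "eqv (four_block_mat X (1\<^sub>m k) (- (N * Di)) (0\<^sub>m q k))
    (four_block_mat (X + 1\<^sub>m k * (- X)) (1\<^sub>m k) (- (N * Di) + 0\<^sub>m q k * (- X)) (0\<^sub>m q k))"
    using c X by (intro eqv_col_left[of _ k k _ k _ q]) (auto intro: Rmat_uminus)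
  moreover have "X + 1\<^sub>m k * (- X) = 0\<^sub>m k k" "- (N * Di) + 0\<^sub>m q k * (- X) = - (N * Di)"
    using c by (auto simp: mat_add_uminus_self)
  moreover have "eqv (four_block_mat (0\<^sub>m k k) (1\<^sub>m k) (- (N * Di)) (0\<^sub>m q k)) (dsum (1\<^sub>m k) (N * Di))"
  proof -
    \<comment> \<open>A column swap with one sign: it brings the identity to the front and turns
      \<open>- (N * Di)\<close> into \<open>N * Di\<close>.\<close>
    let ?J = "four_block_mat (0\<^sub>m k k) (- 1\<^sub>m k) (1\<^sub>m k) (0\<^sub>m k k) :: 'k mat"
    let ?J' = "four_block_mat (0\<^sub>m k k) (1\<^sub>m k) (- 1\<^sub>m k) (0\<^sub>m k k) :: 'k mat"
    have J: "?J \<in> GL (k + k)"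
      by (rule GLI[of _ _ ?J'])
        (auto intro!: Rmat_block Rmat_uminus simp: mult_four_block_mat[of _ k k _ k _ k _ _ k _ k] mat_uminus_zero)
    have "four_block_mat (0\<^sub>m k k) (1\<^sub>m k) (- (N * Di)) (0\<^sub>m q k) * ?J = dsum (1\<^sub>m k) (N * Di)"
      unfolding dsum_def using c
      by (subst mult_four_block_mat[of _ k k _ k _ q _ _ k _ k])
        (auto simp: carrier_matD mat_uminus_zero)
    with eqv_right[OF J, of "four_block_mat (0\<^sub>m k k) (1\<^sub>m k) (- (N * Di)) (0\<^sub>m q k)" "k + q"] c
    show ?thesis by (auto intro: eqv_sym)
  qed
  ultimately show ?thesis by (metis eqv_trans)
qed

text \<open>The fraction with numerator \<open>[A, B; -C, D]\<close> and denominator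
  \<open>dsum A 1\<close> is coprime by the identity for \<open>U\<close> and \<open>V\<close>. Its
  value has pivot 1, right block \<open>B\<close> and lower left block \<open>W\<close>, equal to
  \<open>- (C * Ai)\<close>. Clearing \<open>B\<close> produces the transfer function, and the
  identity for \<open>X\<close> and \<open>Y\<close> makes it possible to clear the non-regular
  \<open>W\<close>.\<close>

lemma eqv_system_matrix:
  assumes A: "A \<in> Rmat n n" and B: "B \<in> Rmat n t" and C: "C \<in> Rmat q n" and D: "D \<in> Rmat q t"
    and Ai: "Ai \<in> carrier_mat n n" and inv: "A * Ai = 1\<^sub>m n" "Ai * A = 1\<^sub>m n"
    and XY: "X \<in> Rmat n n" "Y \<in> Rmat t n" "A * X + B * Y = 1\<^sub>m n"
    and UV: "U \<in> Rmat n n" "V \<in> Rmat n q" "U * A + V * C = 1\<^sub>m n"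
  shows "eqv (dsum (dsum Ai (1\<^sub>m t)) (four_block_mat A B (- C) D))
    (dsum (1\<^sub>m (n + t)) (dsum (1\<^sub>m n) (D + C * Ai * B)))"
proof -
  note c = A[THEN Rmat_carrier] B[THEN Rmat_carrier] C[THEN Rmat_carrier] D[THEN Rmat_carrier] Ai
    XY(1,2)[THEN Rmat_carrier] UV(1,2)[THEN Rmat_carrier]
  let ?L = "four_block_mat A B (- C) D" and ?D = "dsum A (1\<^sub>m t)" and ?Di = "dsum Ai (1\<^sub>m t)"
  define G where "G = D + C * Ai * B"
  define W where "W = - (C * Ai)"
  have Gc: "G \<in> carrier_mat q t" and Wc: "W \<in> carrier_mat q n" unfolding G_def W_def using c by auto
  have "eqv (dsum ?Di ?L) (dsum (1\<^sub>m (n + t)) (?L * ?Di))"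
  proof (rule eqv_coprime_fraction)
    show "?L \<in> Rmat (n + q) (n + t)" using A B C D by (intro Rmat_block Rmat_uminus)
    show "?D \<in> Rmat (n + t) (n + t)" "?Di \<in> carrier_mat (n + t) (n + t)"
      using A c unfolding dsum_def by (auto intro!: Rmat_block)
    show "?D * ?Di = 1\<^sub>m (n + t)" "?Di * ?D = 1\<^sub>m (n + t)"
      using c inv by (auto simp: dsum_mult[of _ n n _ t t _ n _ t] dsum_one)
    \<comment> \<open>The first block column of the identity is \<open>U * A + V * C\<close>. The
      block \<open>V * D\<close> in \<open>?X\<close> compensates the unwanted
      \<open>- (V * D)\<close> that \<open>V\<close> produces from the second row of the system
      matrix.\<close>
    let ?X = "four_block_mat U (V * D) (0\<^sub>m t n) (1\<^sub>m t)"
    let ?Y = "four_block_mat (0\<^sub>m n n) (- V) (0\<^sub>m t n) (0\<^sub>m t q)"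
    show "?X \<in> Rmat (n + t) (n + t)" "?Y \<in> Rmat (n + t) (n + q)"
      using UV D by (auto intro!: Rmat_block Rmat_uminus intro: Rmat_mult)
    have 1: "?X * ?D = four_block_mat (U * A) (V * D) (0\<^sub>m t n) (1\<^sub>m t)"
      unfolding dsum_def using c
      by (subst mult_four_block_mat[of _ n n _ t _ t _ _ n _ t]) (auto simp: carrier_matD)
    have 2: "?Y * ?L = four_block_mat (V * C) (- (V * D)) (0\<^sub>m t n) (0\<^sub>m t t)"
      using c by (subst mult_four_block_mat[of _ n n _ q _ t _ _ n _ t]) auto
    have "V * D \<in> carrier_mat n t" using c by auto
    then show "?X * ?D + ?Y * ?L = 1\<^sub>m (n + t)"
      unfolding 1 2 using c UV(3)
      by (subst add_four_block_mat[of _ n n _ t _ t]) (auto simp: mat_add_uminus_self[of "V * D" n t])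
  qed
  also have "?L * ?Di = four_block_mat (1\<^sub>m n) B W D"
    unfolding dsum_def W_def using c inv
    by (subst mult_four_block_mat[of _ n n _ t _ q _ _ n _ t]) (auto simp: carrier_matD)
  also have "eqv (dsum (1\<^sub>m (n + t)) (four_block_mat (1\<^sub>m n) B W D))
     (dsum (1\<^sub>m (n + t)) (dsum (1\<^sub>m n) G))"
  proof (rule eqv_dsum[OF eqv_refl])
    have "eqv (four_block_mat (1\<^sub>m n) B W D)
      (four_block_mat (1\<^sub>m n) (B + 1\<^sub>m n * (- B)) W (D + W * (- B)))"
      using c B Wc by (intro eqv_col_right) (auto intro: Rmat_uminus)
    moreover have "B + 1\<^sub>m n * (- B) = 0\<^sub>m n t" using c by (auto simp: mat_add_uminus_self)
    moreover have "D + W * (- B) = G"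
    proof -
      have "C * Ai \<in> carrier_mat q n" using c by auto
      then have "W * (- B) = C * Ai * B"
        unfolding W_def using c(2) by (intro eq_matI) auto
      then show ?thesis by (simp add: G_def)
    qed
    moreover have "eqv (four_block_mat (1\<^sub>m n) (0\<^sub>m n t) W G)
      (four_block_mat (1\<^sub>m n + 0\<^sub>m n t * Y) (0\<^sub>m n t) (W + G * Y) G)"
      using c XY(2) Wc Gc by (intro eqv_col_left[of _ n n _ t _ q]) auto
    moreover have "1\<^sub>m n + 0\<^sub>m n t * Y = 1\<^sub>m n" using c by auto
    \<comment> \<open>Inserting \<open>A * X + B * Y\<close> after \<open>C * Ai\<close> gives
      \<open>C * X\<close> plus a term that also occurs in \<open>G * Y\<close>. The difference
      contains no \<open>Ai\<close>, so what remains in the corner is regular and can be cleared by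
      a row operation.\<close>
    moreover have GY: "W + G * Y = D * Y - C * X"
    proof -
      have cai: "C * Ai \<in> carrier_mat q n" using c by auto
      have "C * Ai = C * Ai * (A * X + B * Y)" unfolding XY(3) using right_mult_one_mat[OF cai] by metis
      also have "\<dots> = C * Ai * (A * X) + C * Ai * (B * Y)"
        using c cai by (intro mult_add_distrib_mat) auto
      also have "C * Ai * (A * X) = C * ((Ai * A) * X)"
        using c by (simp add: assoc_mult_mat[of _ q n _ n _ n] assoc_mult_mat[of _ n n _ n _ n] mult_carrier_mat[of _ n n _ n])
      also have "\<dots> = C * X" using inv c by simp
      finally have e1: "C * Ai = C * X + C * Ai * (B * Y)" .
      have e2: "G * Y = D * Y + C * Ai * (B * Y)"
        unfolding G_def using c cai
        by (simp add: add_mult_distrib_mat[of _ q t] assoc_mult_mat[of _ q n _ t _ n] assoc_mult_mat[of C q n Ai n _ n])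
      have z: "C * Ai * (B * Y) \<in> carrier_mat q n" "C * X \<in> carrier_mat q n" "D * Y \<in> carrier_mat q n"
        using c by auto
      show ?thesis unfolding W_def e2
        by (subst e1) (rule mat_cancel_left[OF z(2,1,3)])
    qed
    moreover have "eqv (four_block_mat (1\<^sub>m n) (0\<^sub>m n t) (D * Y - C * X) G)
      (four_block_mat (1\<^sub>m n) (0\<^sub>m n t) ((D * Y - C * X) + (- (D * Y - C * X)) * 1\<^sub>m n)
        (G + (- (D * Y - C * X)) * 0\<^sub>m n t))"
    proof (intro eqv_row_lower[of _ n n _ t _ q])
      have "D * Y + - (C * X) \<in> Rmat q n" using C D XY(1,2) by (intro Rmat_add Rmat_uminus) (auto intro: Rmat_mult)
      moreover have "D * Y + - (C * X) = D * Y - C * X"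
        using c by (intro add_uminus_minus_mat[of _ q n]) auto
      ultimately show "- (D * Y - C * X) \<in> Rmat q n" by (auto intro: Rmat_uminus)
    qed (use c Gc in auto)
    moreover have "(D * Y - C * X) + (- (D * Y - C * X)) * 1\<^sub>m n = 0\<^sub>m q n"
    proof -
      have "D * Y - C * X \<in> carrier_mat q n" using c by auto
      then show ?thesis
        using right_mult_one_mat[of "- (D * Y - C * X)" q n]
          mat_add_uminus_self[of "D * Y - C * X" q n] by (metis uminus_carrier_iff_mat)
    qed
    moreover have "G + (- (D * Y - C * X)) * 0\<^sub>m n t = G"
    proof -
      have "D * Y - C * X \<in> carrier_mat q n" using c by auto
      then show ?thesis
        using right_mult_zero_mat[of "- (D * Y - C * X)" q n t] Gc
        by (metis uminus_carrier_iff_mat right_add_zero_mat)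
    qed
    moreover have "dsum (1\<^sub>m n) G = four_block_mat (1\<^sub>m n) (0\<^sub>m n t) (0\<^sub>m q n) G"
      unfolding dsum_def using Gc by (simp add: carrier_matD)
    ultimately show "eqv (four_block_mat (1\<^sub>m n) B W D) (dsum (1\<^sub>m n) G)" by (metis eqv_trans)
  qed
  finally show ?thesis unfolding G_def .
qed

end

interpretation trivial_val: val_ring "UNIV :: 'k::field set" 1 "\<lambda>_. 0"
  by unfold_locales auto

text \<open>Applied to the values at \<open>z\<close>, this turns the rank conditions of minimality
  into matrix identities.\<close>

lemma full_rank_one_sided_inverse:
  fixes M :: "'k::field mat"
  assumes M: "M \<in> carrier_mat a b"
  shows "mat_rank M = b \<Longrightarrow> \<exists>L \<in> carrier_mat b a. L * M = 1\<^sub>m b"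
    and "mat_rank M = a \<Longrightarrow> \<exists>L \<in> carrier_mat b a. M * L = 1\<^sub>m a"
proof -
  obtain \<nu> where len: "length \<nu> \<le> min a b" and eq: "trivial_val.eqv M (trivial_val.pow_diag a b \<nu>)"
    using trivial_val.smith_form[OF M] by metis
  note rk = trivial_val.mat_rank_eqv_pow_diag[OF M len eq]
  from eq M obtain P Q where PQ: "P \<in> trivial_val.GL a" "Q \<in> trivial_val.GL b" and M_eq: "M = P * trivial_val.pow_diag a b \<nu> * Q"
    by (rule trivial_val.eqvE)
  from PQ obtain P' where P': "P' \<in> trivial_val.GL a" "P' * P = 1\<^sub>m a" "P * P' = 1\<^sub>m a" by (metis trivial_val.GL_inverse)
  from PQ obtain Q' where Q': "Q' \<in> trivial_val.GL b" "Q * Q' = 1\<^sub>m b" "Q' * Q = 1\<^sub>m b" by (metis trivial_val.GL_inverse)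
  note c = PQ[THEN trivial_val.GL_carrier] P'(1)[THEN trivial_val.GL_carrier] Q'(1)[THEN trivial_val.GL_carrier]
  \<comment> \<open>The diagonal of transposed shape with negated exponents is a left inverse of the
    diagonal form if \<open>\<nu>\<close> has length \<open>b\<close>, and a right inverse if it has
    length \<open>a\<close>; one candidate serves both claims.\<close>
  let ?N = "trivial_val.pow_diag b a (map uminus \<nu>)"
  have Lc: "Q' * ?N * P' \<in> carrier_mat b a" using c by auto
  note as = assoc_mult_mat[of _ b b _ a _ a] assoc_mult_mat[of _ b b _ b _ b] assoc_mult_mat[of _ b b _ b _ a] assoc_mult_mat[of _ b b _ a _ b]
    assoc_mult_mat[of _ b a _ a _ b] assoc_mult_mat[of _ b a _ a _ a] assoc_mult_mat[of _ a a _ b _ b]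
    assoc_mult_mat[of _ b a _ b _ b] assoc_mult_mat[of _ a a _ a _ b] assoc_mult_mat[of _ a a _ b _ a]
    assoc_mult_mat[of _ a b _ b _ a] assoc_mult_mat[of _ a b _ b _ b] assoc_mult_mat[of _ a a _ a _ a]
    assoc_mult_mat[of _ a b _ a _ a]
    mult_carrier_mat[of _ a a _ b] mult_carrier_mat[of _ b b _ a] mult_carrier_mat[of _ a b _ b]
    mult_carrier_mat[of _ b a _ a] mult_carrier_mat[of _ a b _ a] mult_carrier_mat[of _ b a _ b]
  {
    assume "mat_rank M = b"
    then have r: "length \<nu> = b" using rk by simp
    have "Q' * ?N * P' * M = Q' * (?N * (P' * P) * trivial_val.pow_diag a b \<nu>) * Q"
      unfolding M_eq using c by (simp add: as)
    also have "?N * (P' * P) * trivial_val.pow_diag a b \<nu> = ?N * trivial_val.pow_diag a b \<nu>"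
      using P' by (simp add: right_mult_one_mat[of _ b a])
    also have "\<dots> = 1\<^sub>m b"
      using len r by (subst trivial_val.pow_diag_mult) (auto simp: map2_uminus trivial_val.pow_diag_one)
    finally have "Q' * ?N * P' * M = 1\<^sub>m b" using Q' c by simp
    with Lc show "\<exists>L \<in> carrier_mat b a. L * M = 1\<^sub>m b" by blast
  }
  {
    assume "mat_rank M = a"
    then have r: "length \<nu> = a" using rk by simp
    have "M * (Q' * ?N * P') = P * (trivial_val.pow_diag a b \<nu> * (Q * Q') * ?N) * P'"
      unfolding M_eq using c by (simp add: as)
    also have "trivial_val.pow_diag a b \<nu> * (Q * Q') * ?N = trivial_val.pow_diag a b \<nu> * ?N"
      using Q' by (simp add: right_mult_one_mat[of _ a b])
    also have "\<dots> = 1\<^sub>m a"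
      using len r by (subst trivial_val.pow_diag_mult) (auto simp: map2_uminus trivial_val.pow_diag_one)
    finally have "M * (Q' * ?N * P') = 1\<^sub>m a" using P' c by simp
    with Lc show "\<exists>L \<in> carrier_mat b a. M * L = 1\<^sub>m a" by blast
  }
qed

section \<open>Orders over a discrete valuation ring\<close>

text \<open>The added axiom excludes the trivial valuation, for which all powers of
  \<open>\<pi>\<close> coincide and exponents are not determined by the matrix.\<close>

locale dvr = val_ring R \<pi> v
  for R :: "'k::field set" and \<pi> :: 'k and v :: "'k \<Rightarrow> int" +
  assumes pi_not_unit: "inverse \<pi> \<notin> R"
begin

lemma powi_R_iff: "\<pi> powi k \<in> R \<longleftrightarrow> 0 \<le> k"
proof
  assume k: "\<pi> powi k \<in> R"
  show "0 \<le> k"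
  proof (rule ccontr)
    assume "\<not> 0 \<le> k"
    then have "\<pi> powi k * \<pi> powi (- k - 1) \<in> R"
      using k powi_R[of "- k - 1"] by (intro mult_R) simp_all
    also have "\<pi> powi k * \<pi> powi (- k - 1) = inverse \<pi>"
      by (simp flip: power_int_add add: power_int_minus)
    finally show False using pi_not_unit by simp
  qed
qed (rule powi_R)

section \<open>Existence and uniqueness of the orders\<close>

text \<open>A matrix that is invertible modulo the maximal ideal \<open>\<pi> R\<close> has no large zero block there:
  by pigeonhole every term of the Leibniz expansion would use an entry of the block.\<close>

lemma GL_zero_block:
  assumes Q: "Q \<in> GL n" and I: "I \<subseteq> {0..<n}" and J: "J \<subseteq> {0..<n}"
    and block: "\<And>i j. i \<in> I \<Longrightarrow> j \<in> J \<Longrightarrow> inverse \<pi> * Q $$ (i, j) \<in> R"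
  shows "card I + card J \<le> n"
proof (rule ccontr)
  assume large: "\<not> card I + card J \<le> n"
  obtain Q' where Q': "Q' \<in> GL n" "Q * Q' = 1\<^sub>m n" using Q by (rule GL_inverse)
  note c = Q[THEN GL_carrier] Q'(1)[THEN GL_carrier]
  have entries: "M $$ (i, j) \<in> R" if "M \<in> GL n" "i < n" "j < n" for M i j
    using that by (auto simp: GL_def Rmat_def)
  have sign: "signof p * x \<in> R" if "x \<in> R" for p :: "nat \<Rightarrow> nat" and x
    using that by (auto simp: sign_def)
  have perm_less: "p i < n" if "p permutes {0..<n}" "i < n" for p i
    using permutes_in_image[OF that(1), of i] that(2) by auto
  have "inverse \<pi> * (signof p * (\<Prod>i = 0..<n. Q $$ (i, p i))) \<in> R" if p: "p permutes {0..<n}" for p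
  proof -
    have "p ` I \<inter> J \<noteq> {}"
    proof
      assume "p ` I \<inter> J = {}"
      moreover have "finite I" "finite J" using I J by (auto intro: finite_subset)
      ultimately have "card (p ` I \<union> J) = card I + card J"
        using permutes_inj_on[OF p, of I] by (simp add: card_Un_disjoint card_image)
      moreover have "p ` I \<union> J \<subseteq> {0..<n}" using I J perm_less[OF p] by fastforce
      then have "card (p ` I \<union> J) \<le> n" using card_mono[of "{0..<n}"] by fastforce
      ultimately show False using large by simp
    qed
    then obtain i where i: "i \<in> I" "p i \<in> J" by auto
    then have "i \<in> {0..<n}" using I by auto
    then have "(\<Prod>i = 0..<n. Q $$ (i, p i)) = Q $$ (i, p i) * (\<Prod>i \<in> {0..<n} - {i}. Q $$ (i, p i))"
      by (intro prod.remove) auto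
    then have "inverse \<pi> * (signof p * (\<Prod>i = 0..<n. Q $$ (i, p i))) =
      (inverse \<pi> * Q $$ (i, p i)) * (signof p * (\<Prod>i \<in> {0..<n} - {i}. Q $$ (i, p i)))"
      by (simp add: ac_simps)
    also have "\<dots> \<in> R"
    proof (rule mult_R[OF block[OF i]], rule sign, rule prod_R)
      fix l assume "l \<in> {0..<n} - {i}"
      then show "Q $$ (l, p l) \<in> R" using perm_less[OF p] by (auto intro: entries[OF Q])
    qed
    finally show ?thesis .
  qed
  \<comment> \<open>The determinant is thus a multiple of \<open>\<pi>\<close>; multiplying by the
    regular \<open>det Q'\<close> would put \<open>inverse \<pi>\<close> into
    \<open>R\<close>.\<close>
  then have "inverse \<pi> * det Q \<in> R"
    unfolding det_def'[OF c(1)] sum_distrib_left by (intro sum_R) auto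
  moreover have "det Q' \<in> R" using Q'(1) by (auto simp: GL_def intro: Rmat_det)
  moreover have "det Q * det Q' = 1" using det_mult[OF c] Q'(2) by simp
  then have "inverse \<pi> * det Q * det Q' = inverse \<pi>" by (simp add: mult.assoc)
  ultimately show False using pi_not_unit mult_R by metis
qed

text \<open>The orders may sit at any set of positions with at most one in each row and column, not only
  on the diagonal; the flexibility makes direct sums immediate.\<close>

definition has_orders :: "'k mat \<Rightarrow> int multiset \<Rightarrow> bool" where
  "has_orders M ms \<longleftrightarrow> (\<exists>S w. S \<subseteq> {0..<dim_row M} \<times> {0..<dim_col M} \<and> inj_on fst S \<and> inj_on snd S \<and>
     ms = image_mset w (mset_set S) \<and>
     eqv M (mat (dim_row M) (dim_col M) (\<lambda>x. if x \<in> S then \<pi> powi w x else 0)))"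

lemma size_filter_image_mset_set:
  "finite S \<Longrightarrow> size (filter_mset P (image_mset w (mset_set S))) = card {x \<in> S. P (w x)}"
  by (simp add: filter_mset_image_mset)

text \<open>Compare entries in \<open>D' Q' = P D\<close>, where \<open>D\<close> and
  \<open>D'\<close> are the placed matrices of \<open>S\<close> and \<open>S'\<close>. A column of
  \<open>D\<close> with no exponent at most \<open>t\<close> makes that column of \<open>P D\<close>
  divisible by \<open>\<pi>\<close> to the power \<open>t + 1\<close>. An entry of \<open>S'\<close>
  with exponent at most \<open>t\<close> picks out a row of \<open>Q'\<close>, multiplied by a
  smaller power. Hence \<open>Q'\<close> vanishes modulo \<open>\<pi>\<close> on the block formed by
  these rows and columns, and \<open>GL_zero_block\<close> gives the inequality.\<close>

lemma eqv_placed_card_le: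
  fixes w w' :: "nat \<times> nat \<Rightarrow> int"
  assumes S: "S \<subseteq> {0..<a} \<times> {0..<b}" "inj_on snd S"
    and S': "S' \<subseteq> {0..<a} \<times> {0..<b}" "inj_on snd S'"
    and eq: "eqv (mat a b (\<lambda>x. if x \<in> S' then \<pi> powi w' x else 0))
                 (mat a b (\<lambda>x. if x \<in> S then \<pi> powi w x else 0))"
    and injS: "inj_on fst S'"
  shows "card {x \<in> S'. w' x \<le> t} \<le> card {x \<in> S. w x \<le> t}"
proof -
  let ?D = "mat a b (\<lambda>x. if x \<in> S then \<pi> powi w x else 0)"
  let ?D' = "mat a b (\<lambda>x. if x \<in> S' then \<pi> powi w' x else 0)"
  obtain P Q where PQ: "P \<in> GL a" "Q \<in> GL b" and D'_eq: "?D' = P * ?D * Q"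
    using eq by (rule eqvE[of _ _ a b]) auto
  obtain Q' where Q': "Q' \<in> GL b" "Q * Q' = 1\<^sub>m b" using PQ(2) by (rule GL_inverse)
  note c = PQ[THEN GL_carrier] Q'(1)[THEN GL_carrier]
  have "?D' * Q' = (P * ?D) * (Q * Q')"
    unfolding D'_eq using c by (intro assoc_mult_mat[of _ a b _ b _ b]) auto
  then have key: "?D' * Q' = P * ?D"
    using Q' c by (simp add: right_mult_one_mat[of _ a b] mult_carrier_mat[of _ a a _ b])
  let ?T = "{x \<in> S. w x \<le> t}" and ?T' = "{x \<in> S'. w' x \<le> t}"
  have fin: "finite S" "finite S'"
    using S(1) S'(1) finite_subset[of _ "{0..<a} \<times> {0..<b}"] by auto
  have "card (snd ` ?T') + card ({0..<b} - snd ` ?T) \<le> b"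
  proof (rule GL_zero_block[OF Q'(1)])
    show "snd ` ?T' \<subseteq> {0..<b}" "{0..<b} - snd ` ?T \<subseteq> {0..<b}" using S'(1) by auto
    fix l j assume l: "l \<in> snd ` ?T'" and j: "j \<in> {0..<b} - snd ` ?T"
    from l obtain i where i: "(i, l) \<in> S'" "w' (i, l) \<le> t" by auto
    then have il: "i < a" "l < b" using S'(1) by auto
    have jb: "j < b" using j by auto
    have row_i: "x = l" if "(i, x) \<in> S'" for x
      using inj_onD[OF injS, of "(i, l)" "(i, x)"] that i by simp
    have "(?D' * Q') $$ (i, j) = (\<Sum>k\<in>{0..<b}. ?D' $$ (i, k) * Q' $$ (k, j))"
      using il jb c by (simp add: scalar_prod_def)
    also have "\<dots> = (\<Sum>k\<in>{0..<b}. if k = l then \<pi> powi w' (i, l) * Q' $$ (l, j) else 0)"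
      using il i by (intro sum.cong) (auto dest: row_i)
    also have "\<dots> = \<pi> powi w' (i, l) * Q' $$ (l, j)" using il by simp
    finally have lhs: "(?D' * Q') $$ (i, j) = \<pi> powi w' (i, l) * Q' $$ (l, j)" .
    have rhs: "(P * ?D) $$ (i, j) = (\<Sum>k\<in>{0..<a}. P $$ (i, k) * ?D $$ (k, j))"
      using il jb c by (simp add: scalar_prod_def)
    \<comment> \<open>One power more is divided out than is needed to isolate the entry of
      \<open>Q'\<close>, which produces \<open>inverse \<pi>\<close>. It is affordable because
      \<open>w (k, j)\<close> is at least \<open>t + 1\<close>.\<close>
    have "\<pi> powi (- w' (i, l) - 1) * (P $$ (i, k) * ?D $$ (k, j)) \<in> R" if k: "k < a" for k
    proof (cases "(k, j) \<in> S")
      case True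
      then have "t < w (k, j)" using j by force
      then have "\<pi> powi (- w' (i, l) - 1 + w (k, j)) \<in> R" using i by (intro powi_R) auto
      moreover have "P $$ (i, k) \<in> R" using PQ(1) il k by (auto simp: GL_def Rmat_def)
      ultimately have "P $$ (i, k) * \<pi> powi (- w' (i, l) - 1 + w (k, j)) \<in> R" by (rule mult_R[rotated])
      then show ?thesis using True k jb by (simp add: power_int_add ac_simps)
    qed (use k jb in simp)
    then have "\<pi> powi (- w' (i, l) - 1) * (P * ?D) $$ (i, j) \<in> R"
      unfolding rhs sum_distrib_left by (intro sum_R) auto
    then have "\<pi> powi (- w' (i, l) - 1) * (\<pi> powi w' (i, l) * Q' $$ (l, j)) \<in> R"
      using key lhs by simp
    also have "\<pi> powi (- w' (i, l) - 1) * (\<pi> powi w' (i, l) * Q' $$ (l, j)) =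
      (\<pi> powi (- w' (i, l) - 1) * \<pi> powi w' (i, l)) * Q' $$ (l, j)" by (simp add: mult.assoc)
    also have "\<pi> powi (- w' (i, l) - 1) * \<pi> powi w' (i, l) = inverse \<pi>"
      by (simp flip: power_int_add add: power_int_minus)
    finally show "inverse \<pi> * Q' $$ (l, j) \<in> R" .
  qed
  moreover have "card (snd ` ?T') = card ?T'"
    using S'(2) by (intro card_image) (auto intro: inj_on_subset)
  moreover have "card (snd ` ?T) = card ?T"
    using S(2) by (intro card_image) (auto intro: inj_on_subset)
  moreover have "snd ` ?T \<subseteq> {0..<b}" using S(1) by auto
  then have "card ({0..<b} - snd ` ?T) = b - card (snd ` ?T)" "card (snd ` ?T) \<le> b"
    using card_mono[of "{0..<b}" "snd ` ?T"] by (auto simp: card_Diff_subset finite_subset)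
  ultimately show ?thesis by simp
qed

text \<open>The multiplicity of \<open>t\<close> is the difference of the counts for the thresholds
  \<open>t\<close> and \<open>t - 1\<close>.\<close>

lemma multiset_eq_by_thresholds:
  fixes M N :: "int multiset"
  assumes "\<And>t. size (filter_mset (\<lambda>k. k \<le> t) M) = size (filter_mset (\<lambda>k. k \<le> t) N)"
  shows "M = N"
proof (rule multiset_eqI)
  have "count K t = size (filter_mset (\<lambda>k. k \<le> t) K) - size (filter_mset (\<lambda>k. k \<le> t - 1) K)"
    for K :: "int multiset" and t
  proof -
    have "filter_mset (\<lambda>k. k \<le> t) K = filter_mset (\<lambda>k. k \<le> t - 1) K + filter_mset (\<lambda>k. k = t) K"
      by (rule multiset_eqI) auto
    then show ?thesis by (simp add: filter_eq_replicate_mset)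
  qed
  then show "count M t = count N t" for t using assms by metis
qed

lemma has_orders_unique:
  assumes "has_orders M ms" "has_orders M ms'"
  shows "ms = ms'"
proof -
  define a b where "a = dim_row M" and "b = dim_col M"
  from assms(1) obtain S w where S: "S \<subseteq> {0..<a} \<times> {0..<b}" "inj_on fst S" "inj_on snd S"
    "ms = image_mset w (mset_set S)" "eqv M (mat a b (\<lambda>x. if x \<in> S then \<pi> powi w x else 0))"
    unfolding has_orders_def a_def b_def by blast
  from assms(2) obtain S' w' where S': "S' \<subseteq> {0..<a} \<times> {0..<b}" "inj_on fst S'" "inj_on snd S'"
    "ms' = image_mset w' (mset_set S')" "eqv M (mat a b (\<lambda>x. if x \<in> S' then \<pi> powi w' x else 0))"
    unfolding has_orders_def a_def b_def by blast
  have fin: "finite S" "finite S'"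
    using S(1) S'(1) finite_subset[of _ "{0..<a} \<times> {0..<b}"] by auto
  show ?thesis
  proof (rule multiset_eq_by_thresholds)
    fix t
    have "card {x \<in> S. w x \<le> t} = card {x \<in> S'. w' x \<le> t}"
      using S S' by (intro antisym; intro eqv_placed_card_le) (auto intro: eqv_trans eqv_sym)
    then show "size (filter_mset (\<lambda>k. k \<le> t) ms) = size (filter_mset (\<lambda>k. k \<le> t) ms')"
      using S(4) S'(4) fin by (simp only: size_filter_image_mset_set)
  qed
qed

lemma has_orders_eqv: "eqv M N \<Longrightarrow> has_orders N ms \<Longrightarrow> has_orders M ms"
  unfolding has_orders_def by (auto simp: eqv_dims intro: eqv_trans)

lemma has_orders_pow_diag:
  assumes "length \<nu> \<le> min a b"
  shows "has_orders (pow_diag a b \<nu>) (mset \<nu>)"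
proof -
  let ?d = "\<lambda>i. (i, i) :: nat \<times> nat" and ?S = "(\<lambda>i. (i, i)) ` {0..<length \<nu>}"
  let ?w = "\<lambda>(i, j :: nat). \<nu> ! i"
  have "mset_set ?S = image_mset ?d (mset_set {0..<length \<nu>})"
    by (rule image_mset_mset_set[symmetric]) (auto intro: inj_onI)
  then have "image_mset ?w (mset_set ?S) = image_mset ((!) \<nu>) (mset_set {0..<length \<nu>})"
    by (simp add: multiset.map_comp o_def)
  also have "\<dots> = mset (map ((!) \<nu>) [0..<length \<nu>])" by simp
  also have "\<dots> = mset \<nu>" by (simp only: map_nth)
  finally have 1: "mset \<nu> = image_mset ?w (mset_set ?S)" by simp
  have 2: "pow_diag a b \<nu> = mat a b (\<lambda>x. if x \<in> ?S then \<pi> powi ?w x else 0)"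
    by (intro eq_matI) auto
  show ?thesis
    unfolding has_orders_def
    by (rule exI[of _ ?S], rule exI[of _ ?w])
      (use assms 1 2 in \<open>auto intro: inj_onI simp flip: 2\<close>)
qed

lemma has_orders_dsum:
  assumes "has_orders M ms" "has_orders N ms'"
  shows "has_orders (dsum M N) (ms + ms')"
proof -
  define a b c d where "a = dim_row M" and "b = dim_col M" and "c = dim_row N" and "d = dim_col N"
  from assms(1) obtain S w where S: "S \<subseteq> {0..<a} \<times> {0..<b}" "inj_on fst S" "inj_on snd S"
    "ms = image_mset w (mset_set S)" "eqv M (mat a b (\<lambda>x. if x \<in> S then \<pi> powi w x else 0))"
    unfolding has_orders_def a_def b_def by blast
  from assms(2) obtain T u where T: "T \<subseteq> {0..<c} \<times> {0..<d}" "inj_on fst T" "inj_on snd T"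
    "ms' = image_mset u (mset_set T)" "eqv N (mat c d (\<lambda>x. if x \<in> T then \<pi> powi u x else 0))"
    unfolding has_orders_def c_def d_def by blast
  \<comment> \<open>The positions of \<open>N\<close> are shifted past those of \<open>M\<close>, so
    the row index alone tells \<open>?w\<close> which weight to use.\<close>
  let ?h = "\<lambda>(i, j). (i + a, j + b)"
  let ?S = "S \<union> ?h ` T"
  let ?w = "\<lambda>(i, j). if i < a then w (i, j) else u (i - a, j - b)"
  have fin: "finite S" "finite T"
    using S(1) T(1) finite_subset[of _ "{0..<a} \<times> {0..<b}"] finite_subset[of _ "{0..<c} \<times> {0..<d}"]
    by auto
  have disj: "S \<inter> ?h ` T = {}" using S(1) by auto
  have injh: "inj_on ?h T" by (auto intro: inj_onI)
  have "mset_set ?S = mset_set S + image_mset ?h (mset_set T)"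
    using fin disj injh by (simp add: mset_set_Union image_mset_mset_set)
  moreover have "image_mset ?w (mset_set S) = image_mset w (mset_set S)"
    using S(1) fin by (intro image_mset_cong) auto
  moreover have "image_mset ?w (image_mset ?h (mset_set T)) = image_mset u (mset_set T)"
    by (auto simp: multiset.map_comp o_def intro!: image_mset_cong)
  ultimately have "ms + ms' = image_mset ?w (mset_set ?S)" using S(4) T(4) by simp
  moreover have "eqv (dsum M N) (dsum (mat a b (\<lambda>x. if x \<in> S then \<pi> powi w x else 0))
      (mat c d (\<lambda>x. if x \<in> T then \<pi> powi u x else 0)))"
    by (rule eqv_dsum[OF S(5) T(5)])
  moreover have "dsum (mat a b (\<lambda>x. if x \<in> S then \<pi> powi w x else 0))
      (mat c d (\<lambda>x. if x \<in> T then \<pi> powi u x else 0)) =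
      mat (a + c) (b + d) (\<lambda>x. if x \<in> ?S then \<pi> powi ?w x else 0)"
  proof (intro eq_matI)
    fix i j assume "i < dim_row (mat (a + c) (b + d) (\<lambda>x. if x \<in> ?S then \<pi> powi ?w x else 0))"
      "j < dim_col (mat (a + c) (b + d) (\<lambda>x. if x \<in> ?S then \<pi> powi ?w x else 0))"
    then have ij: "i < a + c" "j < b + d" by auto
    have mem: "(i, j) \<in> ?h ` T \<longleftrightarrow> a \<le> i \<and> b \<le> j \<and> (i - a, j - b) \<in> T"
      by (auto simp: image_iff intro!: bexI[of _ "(i - a, j - b)"])
    show "dsum (mat a b (\<lambda>x. if x \<in> S then \<pi> powi w x else 0))
      (mat c d (\<lambda>x. if x \<in> T then \<pi> powi u x else 0)) $$ (i, j) =
      mat (a + c) (b + d) (\<lambda>x. if x \<in> ?S then \<pi> powi ?w x else 0) $$ (i, j)"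
      using ij S(1) mem unfolding dsum_def by auto
  qed (auto simp: dsum_def)
  moreover have "inj_on fst ?S"
    using S(1,2) T(2) by (auto simp: inj_on_def) fastforce+
  moreover have "inj_on snd ?S"
    using S(1,3) T(3) by (auto simp: inj_on_def) fastforce+
  moreover have "?S \<subseteq> {0..<a + c} \<times> {0..<b + d}" using S(1) T(1) by auto
  moreover have "dim_row (dsum M N) = a + c" "dim_col (dsum M N) = b + d"
    unfolding dsum_def a_def b_def c_def d_def by auto
  ultimately show ?thesis unfolding has_orders_def by (intro exI[of _ ?S] exI[of _ ?w]) simp
qed

lemma has_orders_one: "has_orders (1\<^sub>m n) (replicate_mset n 0)"
  using has_orders_pow_diag[of "replicate n 0" n n] by (simp add: pow_diag_one)

lemma has_orders_smith:
  assumes M: "M \<in> carrier_mat a b"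
  obtains \<nu> where "sorted \<nu>" "length \<nu> = mat_rank M" "length \<nu> \<le> min a b" "eqv M (pow_diag a b \<nu>)"
    "has_orders M (mset \<nu>)"
proof -
  obtain \<nu> where \<nu>: "sorted \<nu>" "length \<nu> \<le> min a b" "eqv M (pow_diag a b \<nu>)"
    using smith_form[OF M] by metis
  show thesis
    by (rule that[OF \<nu>(1) _ \<nu>(2,3)])
      (use mat_rank_eqv_pow_diag[OF M \<nu>(2,3)] has_orders_eqv[OF \<nu>(3) has_orders_pow_diag[OF \<nu>(2)]] in auto)
qed

lemma has_orders_imp_eqv_pow_diag:
  assumes M: "M \<in> carrier_mat a b" and ms: "has_orders M ms"
  shows "eqv M (pow_diag a b (sorted_list_of_multiset ms))" and "size ms = mat_rank M"
proof -
  obtain \<nu> where \<nu>: "sorted \<nu>" "length \<nu> = mat_rank M" "eqv M (pow_diag a b \<nu>)" "has_orders M (mset \<nu>)"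
    using has_orders_smith[OF M] by metis
  have eq: "ms = mset \<nu>" using has_orders_unique[OF ms \<nu>(4)] .
  then have "\<nu> = sorted_list_of_multiset ms" using \<nu>(1) by (simp add: sorted_sort_id)
  then show "eqv M (pow_diag a b (sorted_list_of_multiset ms))" using \<nu>(3) by simp
  show "size ms = mat_rank M" using eq \<nu>(2) by simp
qed

text \<open>Both matrices are equivalent to the diagonal form of the sorted list of
  \<open>ms\<close>: the orders are a complete invariant for a given size.\<close>

lemma eqv_if_same_orders:
  assumes "M \<in> carrier_mat a b" "N \<in> carrier_mat a b" "has_orders M ms" "has_orders N ms"
  shows "eqv M N"
  using has_orders_imp_eqv_pow_diag(1)[OF assms(1,3)] has_orders_imp_eqv_pow_diag(1)[OF assms(2,4)]
  by (blast intro: eqv_trans eqv_sym)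

text \<open>Regularity passes to the equivalent diagonal form, and a power of \<open>\<pi>\<close>
  is regular only for a nonnegative exponent.\<close>

lemma has_orders_nonneg:
  assumes M: "M \<in> Rmat a b" and ms: "has_orders M ms" and k: "k \<in># ms"
  shows "0 \<le> k"
proof -
  obtain \<nu> where len: "length \<nu> \<le> min a b" and \<nu>: "eqv M (pow_diag a b \<nu>)" "has_orders M (mset \<nu>)"
    using has_orders_smith[OF M[THEN Rmat_carrier]] by metis
  have "ms = mset \<nu>" using has_orders_unique[OF ms \<nu>(2)] .
  then obtain i where i: "i < length \<nu>" "\<nu> ! i = k" using k by (auto simp: in_set_conv_nth)
  have "pow_diag a b \<nu> \<in> Rmat a b" using eqv_Rmat[OF eqv_sym[OF \<nu>(1)] M] .
  then have "pow_diag a b \<nu> $$ (i, i) \<in> R" using i(1) len by (simp add: Rmat_def del: pow_diag_index)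
  then show ?thesis using i len by (simp add: powi_R_iff)
qed

text \<open>Full rank leaves no zero on the diagonal of the Smith form, so the form can be inverted
  factor by factor; the inverse is again in Smith form up to the order of the exponents.\<close>

lemma has_orders_inverse:
  assumes A: "A \<in> carrier_mat n n" and Ai: "Ai \<in> carrier_mat n n"
    and inv: "A * Ai = 1\<^sub>m n" "Ai * A = 1\<^sub>m n" and ms: "has_orders A ms"
  shows "has_orders Ai (image_mset uminus ms)" and "size ms = n"
proof -
  obtain \<nu> where \<nu>: "length \<nu> = mat_rank A" "eqv A (pow_diag n n \<nu>)" "has_orders A (mset \<nu>)"
    using has_orders_smith[OF A] by metis
  have ms_eq: "ms = mset \<nu>" using has_orders_unique[OF ms \<nu>(3)] .
  have len: "length \<nu> = n" using \<nu>(1) mat_rank_left_inverse[OF A Ai inv(2)] by simp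
  then show "size ms = n" using ms_eq by simp
  from \<nu>(2) A obtain P Q where PQ: "P \<in> GL n" "Q \<in> GL n" and A_eq: "A = P * pow_diag n n \<nu> * Q"
    by (rule eqvE)
  from PQ obtain P' where P': "P' \<in> GL n" "P * P' = 1\<^sub>m n" by (metis GL_inverse)
  from PQ obtain Q' where Q': "Q' \<in> GL n" "Q * Q' = 1\<^sub>m n" by (metis GL_inverse)
  note c = PQ[THEN GL_carrier] P'(1)[THEN GL_carrier] Q'(1)[THEN GL_carrier]
  let ?N = "pow_diag n n (map uminus \<nu>)"
  note as = assoc_mult_mat[of _ n n _ n _ n] mult_carrier_mat[of _ n n _ n]
  have "A * (Q' * ?N * P') = P * (pow_diag n n \<nu> * ((Q * Q') * ?N)) * P'"
    unfolding A_eq using c by (simp add: as)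
  also have "(Q * Q') * ?N = ?N" using Q' by (simp add: left_mult_one_mat[of _ n n])
  also have "pow_diag n n \<nu> * ?N = 1\<^sub>m n"
    using len by (subst pow_diag_mult) (auto simp: map2_uminus pow_diag_one)
  finally have "A * (Q' * ?N * P') = 1\<^sub>m n" using P' c by simp
  moreover have "Ai * (A * (Q' * ?N * P')) = (Ai * A) * (Q' * ?N * P')"
    using c A Ai by (intro assoc_mult_mat[symmetric, of _ n n _ n _ n]) auto
  ultimately have "Ai = Q' * ?N * P'" using inv(2) Ai c by simp
  then have "eqv Ai ?N" using eqvI[OF Q'(1) P'(1)] by simp
  moreover have "has_orders ?N (mset (map uminus \<nu>))" using len by (intro has_orders_pow_diag) auto
  ultimately show "has_orders Ai (image_mset uminus ms)"
    using has_orders_eqv ms_eq by simp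
qed

end

section \<open>The local ring of rational functions at a point\<close>

lemma no_pole_Fract: "poly b z \<noteq> 0 \<Longrightarrow> \<not> has_pole_at (Fract a b) z"
  unfolding has_pole_at_def by blast

lemma no_poleE:
  assumes "\<not> has_pole_at f z"
  obtains a b where "poly b z \<noteq> 0" "b \<noteq> 0" "f = Fract a b"
  using assms unfolding has_pole_at_def by (metis poly_0)

lemma no_pole_to_fract: "\<not> has_pole_at (to_fract a) z"
  unfolding to_fract_def by (rule no_pole_Fract) simp

text \<open>The order of vanishing at \<open>z\<close>, negative at a pole. Fractions need not be
  reduced, as \<open>rat_order_Fract\<close> shows the value to be independent of the
  representation. For the zero function no representation qualifies and the value is
  unspecified.\<close>

definition rat_order :: "'a::field \<Rightarrow> 'a poly fract \<Rightarrow> int" where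
  "rat_order z f =
     (THE k. \<exists>a b. a \<noteq> 0 \<and> b \<noteq> 0 \<and> f = Fract a b \<and> k = int (order z a) - int (order z b))"

lemma rat_order_Fract:
  assumes "a \<noteq> 0" "b \<noteq> 0"
  shows "rat_order z (Fract a b) = int (order z a) - int (order z b)"
  unfolding rat_order_def
proof (rule the_equality)
  fix k assume "\<exists>c d. c \<noteq> 0 \<and> d \<noteq> 0 \<and> Fract a b = Fract c d \<and> k = int (order z c) - int (order z d)"
  then obtain c d where cd: "c \<noteq> 0" "d \<noteq> 0" "Fract a b = Fract c d"
    and k: "k = int (order z c) - int (order z d)" by blast
  then have "a * d = c * b" using assms by (simp add: eq_fract)
  moreover have "order z (a * d) = order z a + order z d" "order z (c * b) = order z c + order z b"
    using assms cd by (simp_all add: order_mult)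
  ultimately have "order z a + order z d = order z c + order z b" by simp
  then show "k = int (order z a) - int (order z b)" using k by simp
qed (use assms in blast)

lemma fract_nonzeroE:
  assumes "f \<noteq> 0"
  obtains a b where "a \<noteq> 0" "b \<noteq> 0" "f = Fract a b"
  using assms by (cases f) (auto simp: Zero_fract_def eq_fract)

lemma lin_factor_nz [simp]: "lin_factor z \<noteq> 0"
  by (simp add: lin_factor_def)

lemma Fract_lin_factor:
  "Fract ([:- z, 1:] ^ i * a) ([:- z, 1:] ^ j * b) = lin_factor z powi (int i - int j) * Fract a b"
proof -
  have pw: "to_fract ([:- z, 1:] ^ k) = lin_factor z ^ k" for k
    by (induction k) (simp_all add: lin_factor_def del: mult_pCons_left)
  show ?thesis
    by (simp add: Fract_conv_to_fract pw power_int_diff)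
qed

lemma rat_order_decomp:
  assumes "f \<noteq> 0"
  obtains a b where "poly a z \<noteq> 0" "poly b z \<noteq> 0" "f = lin_factor z powi rat_order z f * Fract a b"
proof -
  obtain a b where ab: "a \<noteq> 0" "b \<noteq> 0" "f = Fract a b" using assms by (rule fract_nonzeroE)
  obtain a' where a': "a = [:- z, 1:] ^ order z a * a'" "poly a' z \<noteq> 0"
    using order_decomp[OF ab(1), of z] by (auto simp: poly_eq_0_iff_dvd)
  obtain b' where b': "b = [:- z, 1:] ^ order z b * b'" "poly b' z \<noteq> 0"
    using order_decomp[OF ab(2), of z] by (auto simp: poly_eq_0_iff_dvd)
  have "f = Fract ([:- z, 1:] ^ order z a * a') ([:- z, 1:] ^ order z b * b')"
    using ab(3) a'(1) b'(1) by simp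
  then have "f = lin_factor z powi rat_order z f * Fract a' b'"
    using rat_order_Fract[OF ab(1,2), of z] ab(3) Fract_lin_factor by metis
  then show thesis using that a' b' by blast
qed

lemma rat_order_lin_factor_powi: "rat_order z (lin_factor z powi k) = k"
proof -
  obtain i j where k: "k = int i - int j" by (metis int_diff_cases)
  have "lin_factor z powi k = Fract ([:- z, 1:] ^ i) ([:- z, 1:] ^ j)"
    using Fract_lin_factor[of z i 1 j 1] by (simp add: k One_fract_def[symmetric])
  then show ?thesis by (simp add: rat_order_Fract order_power_n_n k)
qed

text \<open>The localization of the polynomial ring at \<open>[:- z, 1:]\<close>. The point stays a
  parameter, so the derived notions appear as \<open>loc.GL z\<close> and the like.\<close>

interpretation loc: dvr "{f. \<not> has_pole_at f z}" "lin_factor z" "rat_order z" for z :: "'a::field"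
proof unfold_locales
  let ?R = "{f. \<not> has_pole_at f z}"
  show "1 \<in> ?R" using no_pole_to_fract[of 1 z] by simp
  show "lin_factor z \<in> ?R" unfolding lin_factor_def using no_pole_to_fract by blast
  show "lin_factor z \<noteq> 0" by simp
  fix x y :: "'a poly fract"
  {
    assume x: "x \<in> ?R"
    then obtain a b where ab: "poly b z \<noteq> 0" "b \<noteq> 0" "x = Fract a b" by (auto elim: no_poleE)
    then show "- x \<in> ?R" by (simp add: no_pole_Fract)
    assume "x \<noteq> 0"
    with ab have "a \<noteq> 0" by (auto simp: Zero_fract_def eq_fract)
    then show "0 \<le> rat_order z x" using ab by (simp add: rat_order_Fract order_0I)
  }
  {
    assume "x \<in> ?R" "y \<in> ?R"
    then obtain a b c d where "poly b z \<noteq> 0" "b \<noteq> 0" "x = Fract a b"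
      and "poly d z \<noteq> 0" "d \<noteq> 0" "y = Fract c d" by (auto elim!: no_poleE)
    then show "x + y \<in> ?R" "x * y \<in> ?R" by (simp_all add: no_pole_Fract)
  }
  {
    assume "x \<noteq> 0" "y \<noteq> 0"
    then obtain a b c d where "a \<noteq> 0" "b \<noteq> 0" "x = Fract a b" "c \<noteq> 0" "d \<noteq> 0" "y = Fract c d"
      by (auto elim!: fract_nonzeroE)
    then show "rat_order z (x * y) = rat_order z x + rat_order z y"
      by (simp add: rat_order_Fract order_mult)
  }
  {
    assume "x \<noteq> 0"
    then obtain a b where ab: "poly a z \<noteq> 0" "poly b z \<noteq> 0"
      and x: "x = lin_factor z powi rat_order z x * Fract a b" by (rule rat_order_decomp)
    have nz: "a \<noteq> 0" "b \<noteq> 0" using ab by auto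
    then have inv: "inverse (Fract a b) = Fract b a" by simp
    have "x * lin_factor z powi - rat_order z x = Fract a b"
      by (subst x) (simp add: power_int_minus)
    moreover have "inverse x * lin_factor z powi rat_order z x = Fract b a"
      by (subst x) (simp add: inv)
    ultimately show "x * lin_factor z powi - rat_order z x \<in> ?R \<and>
        inverse x * lin_factor z powi rat_order z x \<in> ?R"
      using ab by (simp add: no_pole_Fract)
  }
  show "rat_order z (lin_factor z powi rat_order z x) = rat_order z x"
    by (rule rat_order_lin_factor_powi)
  show "inverse (lin_factor z) \<notin> ?R"
  proof
    assume "inverse (lin_factor z) \<in> ?R"
    then obtain c d where cd: "poly d z \<noteq> 0" "d \<noteq> 0" "inverse (lin_factor z) = Fract c d"
      by (auto elim: no_poleE)
    have "inverse (lin_factor z) = Fract 1 [:- z, 1:]"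
      by (simp add: lin_factor_def to_fract_def)
    with cd have "d = c * [:- z, 1:]" by (simp add: eq_fract)
    then have "poly d z = poly c z * poly [:- z, 1:] z" by (simp only: poly_mult)
    with cd(1) show False by simp
  qed
qed

text \<open>The units of the local ring are the functions with nonzero value. This translates the
  determinant condition in \<open>regular_mat_at\<close> into the one of
  \<open>GL_iff_det\<close>.\<close>

lemma rat_value_nz_iff:
  assumes "\<not> has_pole_at f z"
  shows "rat_value f z \<noteq> 0 \<longleftrightarrow> (\<exists>u. \<not> has_pole_at u z \<and> f * u = 1)"
proof -
  obtain a b where ab: "poly b z \<noteq> 0" "b \<noteq> 0" "f = Fract a b" using assms by (rule no_poleE)
  have val: "rat_value f z = poly a z / poly b z" using ab by (simp add: rat_value_Fract)
  show ?thesis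
  proof
    assume "rat_value f z \<noteq> 0"
    then have a: "poly a z \<noteq> 0" using val by auto
    then have "a \<noteq> 0" by auto
    then have "f * Fract b a = 1" using ab by (simp add: One_fract_def eq_fract)
    then show "\<exists>u. \<not> has_pole_at u z \<and> f * u = 1" using no_pole_Fract[OF a] by blast
  next
    assume "\<exists>u. \<not> has_pole_at u z \<and> f * u = 1"
    then obtain c d where cd: "poly d z \<noteq> 0" "d \<noteq> 0" "f * Fract c d = 1" by (auto elim: no_poleE)
    then have "a * c = b * d" using ab by (simp add: One_fract_def eq_fract)
    then have "poly a z * poly c z = poly b z * poly d z" by (metis poly_mult)
    then show "rat_value f z \<noteq> 0" using val ab cd by auto
  qed
qed

lemma regular_mat_at_iff_GL:
  assumes "M \<in> carrier_mat n n"
  shows "regular_mat_at M z \<longleftrightarrow> M \<in> loc.GL z n"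
proof (cases "M \<in> loc.Rmat z n n")
  case True
  have "regular_mat_at M z \<longleftrightarrow> rat_value (det M) z \<noteq> 0"
    using True unfolding regular_mat_at_def loc.Rmat_def by auto
  also have "\<dots> \<longleftrightarrow> M \<in> loc.GL z n"
    using loc.GL_iff_det[OF True] loc.Rmat_det[OF True] by (subst rat_value_nz_iff) auto
  finally show ?thesis .
next
  case False
  then show ?thesis using assms unfolding regular_mat_at_def loc.Rmat_def loc.GL_def by auto
qed

lemma local_diag_eq_pow_diag: "local_diag z p m \<nu> = loc.pow_diag z p m \<nu>"
  unfolding local_diag_def loc.pow_diag_def ..

lemma is_invariant_orders_at_iff:
  "is_invariant_orders_at G z \<nu> \<longleftrightarrow> sorted \<nu> \<and> length \<nu> = mat_rank G \<and>
     loc.eqv z G (loc.pow_diag z (dim_row G) (dim_col G) \<nu>)"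
  unfolding is_invariant_orders_at_def loc.eqv_def local_diag_eq_pow_diag
  using loc.GL_carrier regular_mat_at_iff_GL by (auto; blast)

text \<open>Justifies the definite description: elimination provides a sorted list, and uniqueness
  of the orders together with sortedness leaves no other. From here on invariant orders are handled
  only as multisets.\<close>

lemma has_orders_invariant_orders_at:
  "loc.has_orders z G (mset (invariant_orders_at G z))"
proof -
  obtain a b where G: "G \<in> carrier_mat a b" by auto
  obtain \<nu> where \<nu>: "sorted \<nu>" "length \<nu> = mat_rank G" "length \<nu> \<le> min a b"
    "loc.eqv z G (loc.pow_diag z a b \<nu>)" "loc.has_orders z G (mset \<nu>)"
    using loc.has_orders_smith[OF G] by metis
  have "invariant_orders_at G z = \<nu>"
    unfolding invariant_orders_at_def
  proof (rule the_equality)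
    show "is_invariant_orders_at G z \<nu>" using \<nu> G by (simp add: is_invariant_orders_at_iff carrier_matD)
    fix \<mu> assume "is_invariant_orders_at G z \<mu>"
    then have \<mu>: "sorted \<mu>" "length \<mu> = mat_rank G" "loc.eqv z G (loc.pow_diag z a b \<mu>)"
      using G by (simp_all add: is_invariant_orders_at_iff carrier_matD)
    have "loc.has_orders z G (mset \<mu>)"
      using \<mu> \<nu> by (intro loc.has_orders_eqv[OF \<mu>(3)] loc.has_orders_pow_diag) simp
    then have "mset \<mu> = mset \<nu>" using \<nu>(5) by (rule loc.has_orders_unique)
    then show "\<mu> = \<nu>" using \<mu>(1) \<nu>(1) by (metis sorted_list_of_multiset_mset sorted_sort_id)
  qed
  then show ?thesis using \<nu>(5) by simp
qed

section \<open>Minimal system matrices\<close>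

interpretation to_fract_hom: comm_ring_hom to_fract
  by unfold_locales auto

interpretation eval_hom: comm_ring_hom "\<lambda>p. poly p z" for z :: "'a::comm_ring_1"
  by unfold_locales auto

lemma rat_of_poly_mat_Rmat: "M \<in> carrier_mat a b \<Longrightarrow> rat_of_poly_mat M \<in> loc.Rmat z a b"
  unfolding loc.Rmat_def by (auto simp: no_pole_to_fract)

lemma eval_mat_carrier [simp]: "M \<in> carrier_mat a b \<Longrightarrow> eval_mat z M \<in> carrier_mat a b"
  unfolding eval_mat_def by auto

lemma eval_mat_dim [simp]: "dim_row (eval_mat z M) = dim_row M" "dim_col (eval_mat z M) = dim_col M"
  unfolding eval_mat_def by auto

text \<open>The determinant commutes with evaluation and with the embedding into rational functions,
  so it has value 1 at \<open>z\<close> and is a unit of the local ring.\<close>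

lemma rat_of_poly_mat_GL:
  assumes W: "W \<in> carrier_mat n n" and ev: "eval_mat z W = 1\<^sub>m n"
  shows "rat_of_poly_mat W \<in> loc.GL z n"
proof -
  have "poly (det W) z = det (eval_mat z W)" by (simp add: eval_mat_def)
  then have "poly (det W) z = 1" using ev by simp
  then have d: "poly (det W) z \<noteq> 0" "det W \<noteq> 0" by auto
  then have "det (rat_of_poly_mat W) * Fract 1 (det W) = 1"
    by (simp add: to_fract_hom.hom_det to_fract_def One_fract_def eq_fract)
  then show ?thesis
    using loc.GL_iff_det[OF rat_of_poly_mat_Rmat[OF W]] no_pole_Fract[OF d(1), of 1] by blast
qed

lemma side_by_side_mult_append_rows:
  fixes X1 :: "'b::semiring_1 mat"
  assumes "X1 \<in> carrier_mat k a" "X2 \<in> carrier_mat k b" "Y1 \<in> carrier_mat a l" "Y2 \<in> carrier_mat b l"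
  shows "side_by_side X1 X2 * (Y1 @\<^sub>r Y2) = X1 * Y1 + X2 * Y2"
  using assms unfolding side_by_side_def append_rows_def
  by (subst mult_four_block_mat[of _ k a _ b _ 0 _ _ l _ 0]) (auto intro!: eq_matI)

lemma side_by_side_cases:
  fixes L :: "'b::zero mat"
  assumes "L \<in> carrier_mat k (a + b)"
  obtains X1 X2 where "X1 \<in> carrier_mat k a" "X2 \<in> carrier_mat k b" "L = side_by_side X1 X2"
proof (rule that)
  show "L = side_by_side (mat k a (\<lambda>(i, j). L $$ (i, j))) (mat k b (\<lambda>(i, j). L $$ (i, a + j)))"
    using assms unfolding side_by_side_def by (intro eq_matI) auto
qed auto

lemma append_rows_cases:
  fixes L :: "'b::zero mat"
  assumes "L \<in> carrier_mat (a + b) k"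
  obtains Y1 Y2 where "Y1 \<in> carrier_mat a k" "Y2 \<in> carrier_mat b k" "L = Y1 @\<^sub>r Y2"
proof (rule that)
  show "L = mat a k (\<lambda>(i, j). L $$ (i, j)) @\<^sub>r mat b k (\<lambda>(i, j). L $$ (a + i, j))"
    using assms unfolding append_rows_def by (intro eq_matI) auto
qed auto

definition const_mat :: "'a::field mat \<Rightarrow> 'a poly mat" where
  "const_mat = map_mat (\<lambda>c. [:c:])"

lemma const_mat_carrier [simp]: "M \<in> carrier_mat a b \<Longrightarrow> const_mat M \<in> carrier_mat a b"
  unfolding const_mat_def by auto

lemma eval_const_mat [simp]: "eval_mat z (const_mat M) = M"
  unfolding const_mat_def eval_mat_def by (intro eq_matI) auto

lemma eval_mat_mult:
  "M \<in> carrier_mat a b \<Longrightarrow> N \<in> carrier_mat b c \<Longrightarrow> eval_mat z (M * N) = eval_mat z M * eval_mat z N"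
  unfolding eval_mat_def by (rule eval_hom.mat_hom_mult)

lemma eval_mat_add:
  "M \<in> carrier_mat a b \<Longrightarrow> N \<in> carrier_mat a b \<Longrightarrow> eval_mat z (M + N) = eval_mat z M + eval_mat z N"
  unfolding eval_mat_def by (intro eq_matI) auto

lemma rat_of_poly_mat_mult_add:
  assumes "M \<in> carrier_mat a b" "N \<in> carrier_mat b c" "M' \<in> carrier_mat a d" "N' \<in> carrier_mat d c"
  shows "rat_of_poly_mat (M * N + M' * N') =
    rat_of_poly_mat M * rat_of_poly_mat N + rat_of_poly_mat M' * rat_of_poly_mat N'"
proof -
  have "rat_of_poly_mat (M * N + M' * N') = rat_of_poly_mat (M * N) + rat_of_poly_mat (M' * N')"
    using assms by (intro eq_matI) auto
  then show ?thesis
    using to_fract_hom.mat_hom_mult[OF assms(1,2)] to_fract_hom.mat_hom_mult[OF assms(3,4)] by simp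
qed

section \<open>Bezout identities over the local ring\<close>

text \<open>A one-sided inverse of the value at \<open>z\<close> is a one-sided inverse up to a factor which is
  invertible over the local ring.\<close>

lemma bezout_of_full_column_rank:
  assumes A: "A \<in> carrier_mat n n" and C: "C \<in> carrier_mat q n"
    and rk: "mat_rank (eval_mat z A @\<^sub>r eval_mat z C) = n"
  obtains U V where "U \<in> loc.Rmat z n n" "V \<in> loc.Rmat z n q"
    "U * rat_of_poly_mat A + V * rat_of_poly_mat C = 1\<^sub>m n"
proof -
  have "eval_mat z A @\<^sub>r eval_mat z C \<in> carrier_mat (n + q) n" using A C by auto
  from full_rank_one_sided_inverse(1)[OF this rk]
  obtain L where L: "L \<in> carrier_mat n (n + q)" "L * (eval_mat z A @\<^sub>r eval_mat z C) = 1\<^sub>m n" by blast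
  obtain L1 L2 where L12: "L1 \<in> carrier_mat n n" "L2 \<in> carrier_mat n q" "L = side_by_side L1 L2"
    using L(1) by (rule side_by_side_cases)
  have ev: "L1 * eval_mat z A + L2 * eval_mat z C = 1\<^sub>m n"
    using L(2) L12 A C by (simp add: side_by_side_mult_append_rows[of _ n n _ q _ n])
  \<comment> \<open>The constant left inverse is lifted to polynomials: \<open>W\<close> has value 1
    at \<open>z\<close> without being the identity in general, and multiplying by its regular
    inverse gives the exact identity.\<close>
  define W where "W = const_mat L1 * A + const_mat L2 * C"
  have Wc: "W \<in> carrier_mat n n" unfolding W_def using L12 A C
    by (intro add_carrier_mat mult_carrier_mat[of _ n q]) auto
  have "eval_mat z W = 1\<^sub>m n"
    unfolding W_def using L12 A C ev
    by (simp add: eval_mat_add[of _ n n] eval_mat_mult[of _ n n _ n] eval_mat_mult[of _ n q _ n]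
        mult_carrier_mat[of _ n n _ n] mult_carrier_mat[of _ n q _ n])
  from loc.GL_inverse[OF rat_of_poly_mat_GL[OF Wc this]]
  obtain W' where W': "W' \<in> loc.GL z n" "W' * rat_of_poly_mat W = 1\<^sub>m n" by metis
  have W'R: "W' \<in> loc.Rmat z n n" using W'(1) by (simp add: loc.GL_def)
  let ?L1 = "rat_of_poly_mat (const_mat L1)" and ?L2 = "rat_of_poly_mat (const_mat L2)"
  let ?A = "rat_of_poly_mat A" and ?C = "rat_of_poly_mat C"
  have c: "?L1 \<in> carrier_mat n n" "?L2 \<in> carrier_mat n q" "?A \<in> carrier_mat n n" "?C \<in> carrier_mat q n"
    "W' \<in> carrier_mat n n"
    using L12 A C W'R[THEN loc.Rmat_carrier] by auto
  have "W' * ?L1 * ?A + W' * ?L2 * ?C = W' * (?L1 * ?A) + W' * (?L2 * ?C)"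
    using assoc_mult_mat[OF c(5,1,3)] assoc_mult_mat[OF c(5,2,4)] by simp
  also have "\<dots> = W' * (?L1 * ?A + ?L2 * ?C)"
    using c by (intro mult_add_distrib_mat[symmetric]) auto
  also have "?L1 * ?A + ?L2 * ?C = rat_of_poly_mat W"
    unfolding W_def
    by (rule rat_of_poly_mat_mult_add[symmetric, OF const_mat_carrier[OF L12(1)] A const_mat_carrier[OF L12(2)] C])
  finally have "W' * ?L1 * ?A + W' * ?L2 * ?C = 1\<^sub>m n" using W' by simp
  moreover have "W' * ?L1 \<in> loc.Rmat z n n" "W' * ?L2 \<in> loc.Rmat z n q"
    by (intro loc.Rmat_mult[OF W'R] rat_of_poly_mat_Rmat const_mat_carrier L12)+
  ultimately show thesis using that by blast
qed

text \<open>The transposed situation, with the correction factor \<open>W'\<close> on the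
  right.\<close>

lemma bezout_of_full_row_rank:
  assumes A: "A \<in> carrier_mat n n" and B: "B \<in> carrier_mat n t"
    and rk: "mat_rank (side_by_side (eval_mat z A) (eval_mat z B)) = n"
  obtains X Y where "X \<in> loc.Rmat z n n" "Y \<in> loc.Rmat z t n"
    "rat_of_poly_mat A * X + rat_of_poly_mat B * Y = 1\<^sub>m n"
proof -
  have "side_by_side (eval_mat z A) (eval_mat z B) \<in> carrier_mat n (n + t)"
    using A B unfolding side_by_side_def by (intro carrier_matI) auto
  from full_rank_one_sided_inverse(2)[OF this rk]
  obtain L where L: "L \<in> carrier_mat (n + t) n" "side_by_side (eval_mat z A) (eval_mat z B) * L = 1\<^sub>m n"
    by blast
  obtain L1 L2 where L12: "L1 \<in> carrier_mat n n" "L2 \<in> carrier_mat t n" "L = L1 @\<^sub>r L2"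
    using L(1) by (rule append_rows_cases)
  have ev: "eval_mat z A * L1 + eval_mat z B * L2 = 1\<^sub>m n"
    using L(2) L12 A B by (simp add: side_by_side_mult_append_rows[of _ n n _ t _ n])
  define W where "W = A * const_mat L1 + B * const_mat L2"
  have Wc: "W \<in> carrier_mat n n" unfolding W_def using L12 A B
    by (intro add_carrier_mat mult_carrier_mat[of _ n t]) auto
  have "eval_mat z W = 1\<^sub>m n"
    unfolding W_def using L12 A B ev
    by (simp add: eval_mat_add[of _ n n] eval_mat_mult[of _ n n _ n] eval_mat_mult[of _ n t _ n]
        mult_carrier_mat[of _ n n _ n] mult_carrier_mat[of _ n t _ n])
  from loc.GL_inverse[OF rat_of_poly_mat_GL[OF Wc this]]
  obtain W' where W': "W' \<in> loc.GL z n" "rat_of_poly_mat W * W' = 1\<^sub>m n" by metis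
  have W'R: "W' \<in> loc.Rmat z n n" using W'(1) by (simp add: loc.GL_def)
  let ?L1 = "rat_of_poly_mat (const_mat L1)" and ?L2 = "rat_of_poly_mat (const_mat L2)"
  let ?A = "rat_of_poly_mat A" and ?B = "rat_of_poly_mat B"
  have c: "?L1 \<in> carrier_mat n n" "?L2 \<in> carrier_mat t n" "?A \<in> carrier_mat n n" "?B \<in> carrier_mat n t"
    "W' \<in> carrier_mat n n"
    using L12 A B W'R[THEN loc.Rmat_carrier] by auto
  have "?A * (?L1 * W') + ?B * (?L2 * W') = ?A * ?L1 * W' + ?B * ?L2 * W'"
    using assoc_mult_mat[OF c(3,1,5)] assoc_mult_mat[OF c(4,2,5)] by simp
  also have "\<dots> = (?A * ?L1 + ?B * ?L2) * W'"
    using c by (intro add_mult_distrib_mat[symmetric]) auto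
  also have "?A * ?L1 + ?B * ?L2 = rat_of_poly_mat W"
    unfolding W_def
    by (rule rat_of_poly_mat_mult_add[symmetric, OF A const_mat_carrier[OF L12(1)] B const_mat_carrier[OF L12(2)]])
  finally have "?A * (?L1 * W') + ?B * (?L2 * W') = 1\<^sub>m n" using W' by simp
  moreover have "?L1 * W' \<in> loc.Rmat z n n" "?L2 * W' \<in> loc.Rmat z t n"
    by (intro loc.Rmat_mult[OF _ W'R] rat_of_poly_mat_Rmat const_mat_carrier L12)+
  ultimately show thesis using that by blast
qed

abbreviation orders :: "'a::field rat_mat \<Rightarrow> 'a \<Rightarrow> int multiset" where
  "orders G z \<equiv> mset (invariant_orders_at G z)"

lemma minimal_bezout:
  assumes A: "A \<in> carrier_mat n n" and B: "B \<in> carrier_mat n t" and C: "C \<in> carrier_mat q n"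
    and "minimal_at n A B C z"
  obtains X Y U V where "X \<in> loc.Rmat z n n" "Y \<in> loc.Rmat z t n"
    "rat_of_poly_mat A * X + rat_of_poly_mat B * Y = 1\<^sub>m n"
    "U \<in> loc.Rmat z n n" "V \<in> loc.Rmat z n q"
    "U * rat_of_poly_mat A + V * rat_of_poly_mat C = 1\<^sub>m n"
proof (cases "n = 0")
  case True
  \<comment> \<open>For \<open>n = 0\<close> both identities compare empty matrices, so zero
    matrices of the right sizes serve.\<close>
  show ?thesis
    by (rule that[of "0\<^sub>m n n" "0\<^sub>m t n" "0\<^sub>m n n" "0\<^sub>m n q"])
      (use A B C True in \<open>auto intro!: eq_matI\<close>)
next
  case False
  then have rk: "mat_rank (eval_mat z A @\<^sub>r eval_mat z C) = n"
    "mat_rank (side_by_side (eval_mat z A) (eval_mat z B)) = n"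
    using assms(4) by (auto simp: minimal_at_def)
  show ?thesis
    using bezout_of_full_row_rank[OF A B rk(2)] bezout_of_full_column_rank[OF A C rk(1)] that
    by metis
qed

text \<open>The final equation compares the orders of the two sides of
  \<open>eqv_system_matrix\<close>; the replicated zeros come from the identity blocks. It is left
  uncancelled, since later only its size and its nonzero multiplicities are read off.\<close>

lemma transfer_function_orders:
  assumes sys: "polynomial_system n q t A B C D" and mini: "minimal_at n A B C z"
  defines "G \<equiv> transfer_function A B C D"
  defines "oA \<equiv> orders (rat_of_poly_mat A) z"
    and "oL \<equiv> orders (rat_of_poly_mat (system_matrix A B C D)) z"
  shows "G \<in> carrier_mat q t" "size oA = n" "\<forall>k \<in># oA. 0 \<le> k" "\<forall>k \<in># oL. 0 \<le> k"
    "replicate_mset (n + t) 0 + (replicate_mset n 0 + orders G z) =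
     (image_mset uminus oA + replicate_mset t 0) + oL"
proof -
  have c: "A \<in> carrier_mat n n" "B \<in> carrier_mat n t" "C \<in> carrier_mat q n" "D \<in> carrier_mat q t"
    using sys by (auto simp: polynomial_system_def)
  \<comment> \<open>The system condition says nothing for \<open>n = 0\<close>, but the empty
    determinant is 1.\<close>
  have "det A \<noteq> 0"
    using sys c(1) by (cases "n = 0") (auto simp: polynomial_system_def det_dim_zero)
  let ?A = "rat_of_poly_mat A" and ?B = "rat_of_poly_mat B" and ?C = "rat_of_poly_mat C"
    and ?D = "rat_of_poly_mat D"
  have cr: "?A \<in> loc.Rmat z n n" "?B \<in> loc.Rmat z n t" "?C \<in> loc.Rmat z q n" "?D \<in> loc.Rmat z q t"
    using c by (auto intro: rat_of_poly_mat_Rmat)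
  have Ac: "?A \<in> carrier_mat n n" using c by auto
  have "det ?A \<noteq> 0" using \<open>det A \<noteq> 0\<close> by (simp add: to_fract_hom.hom_det)
  \<comment> \<open>This ensures that \<open>the\<close> in \<open>transfer_function\<close> denotes
    the actual inverse.\<close>
  then have "mat_inverse ?A \<noteq> None"
    using mat_inverse(1)[OF Ac, where b = "()"] det_non_zero_imp_unit[OF Ac, where b = "()"] by blast
  then obtain Ai where Ai: "mat_inverse ?A = Some Ai" by auto
  note inv = mat_inverse(2)[OF Ac Ai]
  have G_eq: "G = ?D + ?C * Ai * ?B" unfolding G_def transfer_function_def Ai by simp
  then show Gc: "G \<in> carrier_mat q t" using c inv by auto
  have L_eq: "rat_of_poly_mat (system_matrix A B C D) = four_block_mat ?A ?B (- ?C) ?D"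
    unfolding system_matrix_def using c by (intro eq_matI) auto
  obtain X Y U V where bez: "X \<in> loc.Rmat z n n" "Y \<in> loc.Rmat z t n" "?A * X + ?B * Y = 1\<^sub>m n"
    "U \<in> loc.Rmat z n n" "V \<in> loc.Rmat z n q" "U * ?A + V * ?C = 1\<^sub>m n"
    using minimal_bezout[OF c(1-3) mini] by metis
  have oA: "loc.has_orders z ?A oA" unfolding oA_def by (rule has_orders_invariant_orders_at)
  have oL: "loc.has_orders z (four_block_mat ?A ?B (- ?C) ?D) oL"
    unfolding oL_def L_eq[symmetric] by (rule has_orders_invariant_orders_at)
  have LR: "four_block_mat ?A ?B (- ?C) ?D \<in> loc.Rmat z (n + q) (n + t)"
    using cr by (intro loc.Rmat_block loc.Rmat_uminus)
  show "size oA = n" using loc.has_orders_inverse(2)[OF Ac _ _ _ oA] inv by blast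
  show "\<forall>k \<in># oA. 0 \<le> k" using loc.has_orders_nonneg[OF cr(1) oA] by blast
  show "\<forall>k \<in># oL. 0 \<le> k" using loc.has_orders_nonneg[OF LR oL] by blast
  have oAi: "loc.has_orders z Ai (image_mset uminus oA)"
    using loc.has_orders_inverse(1)[OF Ac _ _ _ oA] inv by blast
  let ?M = "dsum (dsum Ai (1\<^sub>m t)) (four_block_mat ?A ?B (- ?C) ?D)"
  let ?N = "dsum (1\<^sub>m (n + t)) (dsum (1\<^sub>m n) G)"
  have "loc.eqv z ?M ?N"
    unfolding G_eq using inv by (intro loc.eqv_system_matrix[OF cr _ _ _ bez]) auto
  moreover have "loc.has_orders z ?M ((image_mset uminus oA + replicate_mset t 0) + oL)"
    by (intro loc.has_orders_dsum oAi oL loc.has_orders_one)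
  moreover have "loc.has_orders z ?N (replicate_mset (n + t) 0 + (replicate_mset n 0 + orders G z))"
    by (intro loc.has_orders_dsum has_orders_invariant_orders_at loc.has_orders_one)
  ultimately show "replicate_mset (n + t) 0 + (replicate_mset n 0 + orders G z) =
     (image_mset uminus oA + replicate_mset t 0) + oL"
    using loc.has_orders_unique loc.has_orders_eqv by blast
qed

section \<open>Linearizations and elementary divisors in terms of orders\<close>

lemma diag_one_eq_dsum: "diag_one M s = dsum M (1\<^sub>m s)"
  unfolding diag_one_def dsum_def by simp

lemma has_orders_diag_one:
  "loc.has_orders z (diag_one M s) (orders M z + replicate_mset s 0)"
  unfolding diag_one_eq_dsum
  by (intro loc.has_orders_dsum has_orders_invariant_orders_at loc.has_orders_one)

text \<open>The identity blocks contribute \<open>s1\<close> and \<open>s2\<close> zeros, of which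
  \<open>s2\<close> cancel because \<open>s1 = s + s2\<close>. Conversely the choice
  \<open>s1 = s\<close>, \<open>s2 = 0\<close> suffices, since equal orders and equal size give
  equivalence. The left-hand side repeats the clause of \<open>is_linearization_at\<close> so that
  it can be rewritten.\<close>

lemma locally_equivalent_iff_orders:
  assumes G: "G \<in> carrier_mat p m" and H: "H \<in> carrier_mat (p + s) (m + s)"
  shows "(\<exists>s1 s2 :: nat. int s1 - int s2 = int (p + s) - int (dim_row G) \<and>
        int s1 - int s2 = int (m + s) - int (dim_col G) \<and>
        (\<exists>R1 \<in> carrier_mat (dim_row G + s1) (dim_row G + s1).
         \<exists>R2 \<in> carrier_mat (dim_col G + s1) (dim_col G + s1).
           regular_mat_at R1 z \<and> regular_mat_at R2 z \<and>
           R1 * diag_one G s1 * R2 = diag_one H s2)) \<longleftrightarrow>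
     orders H z = orders G z + replicate_mset s 0"
    (is "?lhs \<longleftrightarrow> ?rhs")
proof
  have dG: "dim_row G = p" "dim_col G = m" using G by auto
  have diagG: "diag_one G r \<in> carrier_mat (p + r) (m + r)" for r
    using G by (simp add: diag_one_eq_dsum dsum_carrier)
  {
    assume ?lhs
    then obtain s1 s2 :: nat and R1 R2 where s12: "int s1 - int s2 = int s"
      and R: "R1 \<in> carrier_mat (p + s1) (p + s1)" "R2 \<in> carrier_mat (m + s1) (m + s1)"
        "regular_mat_at R1 z" "regular_mat_at R2 z"
      and eq: "R1 * diag_one G s1 * R2 = diag_one H s2"
      unfolding dG by auto
    have "R1 \<in> loc.GL z (p + s1)" "R2 \<in> loc.GL z (m + s1)"
      using R regular_mat_at_iff_GL by blast+
    then have "loc.eqv z (diag_one H s2) (diag_one G s1)"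
      using diagG eq[symmetric] by (rule loc.eqvI)
    then have "orders H z + replicate_mset s2 0 = orders G z + replicate_mset s1 0"
      using loc.has_orders_unique loc.has_orders_eqv has_orders_diag_one by blast
    moreover have "s1 = s + s2" using s12 by simp
    then have "replicate_mset s1 (0 :: int) = replicate_mset s 0 + replicate_mset s2 0"
      by (intro multiset_eqI) simp
    ultimately show ?rhs by (simp add: add.assoc[symmetric])
  }
  {
    assume ?rhs
    then have "loc.eqv z H (diag_one G s)"
      using loc.eqv_if_same_orders[OF H diagG] has_orders_invariant_orders_at has_orders_diag_one
      by metis
    then obtain P Q where PQ: "P \<in> loc.GL z (p + s)" "Q \<in> loc.GL z (m + s)"
      and eq: "H = P * diag_one G s * Q" using H by (rule loc.eqvE)
    have "regular_mat_at P z" "regular_mat_at Q z"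
      using PQ regular_mat_at_iff_GL loc.GL_carrier by blast+
    moreover have "diag_one H 0 = H" unfolding diag_one_def by (intro eq_matI) auto
    ultimately have ex: "\<exists>R1 \<in> carrier_mat (p + s) (p + s). \<exists>R2 \<in> carrier_mat (m + s) (m + s).
        regular_mat_at R1 z \<and> regular_mat_at R2 z \<and> R1 * diag_one G s * R2 = diag_one H 0"
      using PQ[THEN loc.GL_carrier] eq by metis
    show ?lhs
      unfolding dG by (rule exI[of _ s], rule exI[of _ "0 :: nat"], intro conjI ex) simp_all
  }
qed

text \<open>\<open>rat_order z\<close> recovers the exponent, so elementary divisors can be compared
  through their exponents.\<close>

lemma image_mset_lin_factor_powi_eq_iff:
  "image_mset (\<lambda>k. lin_factor z powi k) M = image_mset (\<lambda>k. lin_factor z powi k) N \<longleftrightarrow> M = N"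
proof
  assume "image_mset (\<lambda>k. lin_factor z powi k) M = image_mset (\<lambda>k. lin_factor z powi k) N"
  then have "image_mset (rat_order z) (image_mset (\<lambda>k. lin_factor z powi k) M) =
    image_mset (rat_order z) (image_mset (\<lambda>k. lin_factor z powi k) N)" by simp
  then show "M = N" by (simp add: multiset.map_comp o_def rat_order_lin_factor_powi)
qed simp

lemma count_image_mset_uminus: "count (image_mset uminus M) (k::int) = count M (- k)"
  by (induction M) auto

text \<open>Once all other multiplicities agree, the size determines that of 0. The rank condition
  will supply the size, the elementary divisors the rest.\<close>

lemma multiset_eq_off_zero:
  fixes M N :: "int multiset"
  shows "M = N \<longleftrightarrow> size M = size N \<and> (\<forall>k. k \<noteq> 0 \<longrightarrow> count M k = count N k)"
proof (intro iffI; clarify?)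
  assume sz: "size M = size N" and cnt: "\<forall>k. k \<noteq> 0 \<longrightarrow> count M k = count N k"
  have split: "size K = size (filter_mset (\<lambda>k. k \<noteq> 0) K) + count K 0" for K :: "int multiset"
    by (induction K) auto
  have "filter_mset (\<lambda>k. k \<noteq> 0) M = filter_mset (\<lambda>k. k \<noteq> 0) N"
    using cnt by (intro multiset_eqI) auto
  then have "count M 0 = count N 0" using sz split[of M] split[of N] by simp
  then show "M = N" using cnt by (intro multiset_eqI) metis
qed auto

theorem theorem4p8:
  fixes G :: "'a::alg_closed_field rat_mat"
    and z :: 'a
    and A0 A1 B0 B1 C0 C1 D0 D1 :: "'a mat"
    and A B C D :: "'a poly mat"
    and p m n s :: nat
  assumes "G \<in> carrier_mat p m"
    and "A0 \<in> carrier_mat n n" "A1 \<in> carrier_mat n n"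
    and "B0 \<in> carrier_mat n (m + s)" "B1 \<in> carrier_mat n (m + s)"
    and "C0 \<in> carrier_mat (p + s) n" "C1 \<in> carrier_mat (p + s) n"
    and "D0 \<in> carrier_mat (p + s) (m + s)" "D1 \<in> carrier_mat (p + s) (m + s)"
    and "A = pencil A1 A0" "B = pencil B1 B0" "C = pencil C1 C0" "D = pencil D1 D0"
    and "linear_polynomial_system n (p + s) (m + s) A B C D"
    and "minimal_at n A B C z"
  shows "is_linearization_at n (p + s) (m + s) A B C D G z \<longleftrightarrow>
           mat_rank (rat_of_poly_mat (system_matrix A B C D)) = mat_rank G + n + s \<and>
           pole_elementary_divisors G z = elementary_divisors A z \<and>
           zero_elementary_divisors G z = elementary_divisors (system_matrix A B C D) z"
proof -
  let ?L = "rat_of_poly_mat (system_matrix A B C D)"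
  define H where "H = transfer_function A B C D"
  define oG where "oG = orders G z"
  define oH where "oH = orders H z"
  define oA where "oA = orders (rat_of_poly_mat A) z"
  define oL where "oL = orders ?L z"
  have sys: "polynomial_system n (p + s) (m + s) A B C D"
    using assms(14) by (simp add: linear_polynomial_system_def)
  note tf = transfer_function_orders[OF sys assms(15),
      folded H_def oA_def oL_def, folded oH_def]
  have oA_neg: "count oA k = 0" and oL_neg: "count oL k = 0" if "k < 0" for k
    using tf(3,4) that by (auto simp: not_in_iff[symmetric])
  \<comment> \<open>Away from 0 the replicated zeros disappear. The negated orders of
    \<open>A\<close> are nonpositive and those of the system matrix nonnegative, so only one summand
    counts for each sign.\<close>
  have count_oH: "count oH k = (if k < 0 then count oA (- k) else count oL k)" if "k \<noteq> 0" for k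
    using arg_cong[OF tf(5), of "\<lambda>M. count M k"] that oA_neg[of "- k"] oL_neg[of k]
    by (auto simp: count_image_mset_uminus)
  \<comment> \<open>As \<open>A\<close> has exactly \<open>n\<close> orders, the sizes give
    \<open>2 n + t + size oH = n + t + size oL\<close>, where \<open>t\<close> is
    \<open>m + s\<close>.\<close>
  have size_oH: "size oH + n = size oL"
    using arg_cong[OF tf(5), of size] tf(2) by simp
  have rank: "mat_rank M = size (orders M z)" for M :: "'a rat_mat"
    using loc.has_orders_imp_eqv_pow_diag(2)[OF _ has_orders_invariant_orders_at[of z M],
      of "dim_row M" "dim_col M"] by auto
  have poles: "pole_elementary_divisors G z = elementary_divisors A z \<longleftrightarrow>
    (\<forall>k<0. count oG k = count oA (- k))"
  proof -
    have "pole_elementary_divisors G z =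
      image_mset (\<lambda>k. lin_factor z powi k) (image_mset uminus (filter_mset (\<lambda>k. k < 0) oG))"
      unfolding pole_elementary_divisors_def oG_def by (simp add: multiset.map_comp o_def)
    then have "pole_elementary_divisors G z = elementary_divisors A z \<longleftrightarrow>
      image_mset uminus (filter_mset (\<lambda>k. k < 0) oG) = filter_mset (\<lambda>k. k \<noteq> 0) oA"
      unfolding elementary_divisors_def oA_def by (simp only: image_mset_lin_factor_powi_eq_iff)
    also have "\<dots> \<longleftrightarrow> (\<forall>j. (if 0 < j then count oG (- j) else 0) = (if j \<noteq> 0 then count oA j else 0))"
      by (simp add: multiset_eq_iff count_image_mset_uminus)
    also have "\<dots> \<longleftrightarrow> (\<forall>k<0. count oG k = count oA (- k))"
      using oA_neg by (auto; metis minus_minus neg_0_less_iff_less neg_less_0_iff_less linorder_less_linear)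
    finally show ?thesis .
  qed
  have zeros: "zero_elementary_divisors G z = elementary_divisors (system_matrix A B C D) z \<longleftrightarrow>
    (\<forall>k>0. count oG k = count oL k)"
  proof -
    have "zero_elementary_divisors G z = elementary_divisors (system_matrix A B C D) z \<longleftrightarrow>
      filter_mset (\<lambda>k. k > 0) oG = filter_mset (\<lambda>k. k \<noteq> 0) oL"
      unfolding zero_elementary_divisors_def elementary_divisors_def oG_def oL_def
      by (simp only: image_mset_lin_factor_powi_eq_iff)
    also have "\<dots> \<longleftrightarrow> (\<forall>k>0. count oG k = count oL k)"
      using oL_neg by (auto simp: multiset_eq_iff neq_iff)
    finally show ?thesis .
  qed
  \<comment> \<open>Linearity and minimality are assumed, so only the clause about local equivalence
    is left.\<close>
  have "is_linearization_at n (p + s) (m + s) A B C D G z \<longleftrightarrow> oH = oG + replicate_mset s 0"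
    unfolding is_linearization_at_def oH_def oG_def
    using assms(14,15) locally_equivalent_iff_orders[OF assms(1) tf(1)] by (simp only: H_def simp_thms)
  also have "\<dots> \<longleftrightarrow> size oH = size oG + s \<and> (\<forall>k. k \<noteq> 0 \<longrightarrow> count oH k = count oG k)"
    by (subst multiset_eq_off_zero) auto
  \<comment> \<open>The number of orders is the normal rank, and \<open>size_oH\<close> accounts for
    the summand \<open>n\<close>.\<close>
  also have "size oH = size oG + s \<longleftrightarrow> mat_rank ?L = mat_rank G + n + s"
    using size_oH by (auto simp: rank[of ?L] rank[of G] oG_def[symmetric] oL_def[symmetric])
  also have "(\<forall>k. k \<noteq> 0 \<longrightarrow> count oH k = count oG k) \<longleftrightarrow>
    (\<forall>k<0. count oG k = count oA (- k)) \<and> (\<forall>k>0. count oG k = count oL k)"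
    using count_oH by (auto simp: neq_iff)
  finally show ?thesis using poles zeros by simp
qed

end
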